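(* Let $d=1$, let $R$ be an integer with $|R|\ge2$, $B\subset\mathbb{Z}$ finite with $0\in B$, $N:=|B|$, such that $\mu=\mu(R,B)$ has no overlap. Let $L\subset\mathbb{Z}$ be finite with $0\in L$ and $(\alpha_l)_{l\in L}$ nonzero complex numbers with $\alpha_0=1$ such that the matrix $\frac{1}{\sqrt N}\left(e^{2\pi i lb/R}\alpha_l\right)_{l\in L,b\in B}$ has orthonormal columns. Assume that for all $l\in L$ with $l\neq0$, $$[l]\cap L\neq\{l'\in L: l'\equiv l\pmod R\}.$$ Then $\left\{\Big(\prod_{i=0}^k\alpha_{l_i}\Big)e_{l_0+Rl_1+\dots+R^kl_k}: l_0\dots l_k\in\Omega(L)\right\}$ is a Parseval frame for $L^2(\mu)$.
   Context: $\tau_b(x)=(x+b)/R$; $\mu(R,B)$ is the unique Borel probability measure with $\mu(E)=\frac1N\sum_b\mu(\tau_b^{-1}(E))$, supported on the attractor $X_B=\bigcup_b\tau_b(X_B)$; no overlap means $\mu(\tau_b(X_B)\cap\tau_{b'}(X_B))=0$ for $b\ne b'$. $e_\lambda(x)=e^{2\pi i\lambda x}$. For $k\in\mathbb{Z}$, $[k]=\{k'\in\mathbb{Z}:(k'-k)b/R\in\mathbb{Z}\ \forall b\in B\}$. $\Omega(L)$: the empty word (giving $e_0$ with weight 1) and all words $l_0\dots l_k$ with $l_i\in L$, $l_k\ne0$. Parseval frame: $\sum_i|\langle v,f_i\rangle|^2=\|v\|^2$ for all $v$. *)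

theory Defs
  imports "HOL-Probability.Probability" "HOL-Number_Theory.Cong"
begin

definition tau :: "int \<Rightarrow> int \<Rightarrow> real \<Rightarrow> real" where
  "tau R b x = (x + of_int b) / of_int R"

text \<open>\<open>M\<close> is the invariant (self-similar) Borel probability measure \<open>\<mu>(R,B)\<close>:
  \<open>\<mu>(E) = (1/N) \<Sum>_b \<mu>(\<tau>_b^{-1}(E))\<close>. (It is unique, so any such measure is \<open>\<mu>(R,B)\<close>.)\<close>
definition is_ifs_measure :: "int \<Rightarrow> int set \<Rightarrow> real measure \<Rightarrow> bool" where
  "is_ifs_measure R B M \<longleftrightarrow> prob_space M \<and> sets M = sets borel \<and>
     (\<forall>E\<in>sets borel. measure M E =
        (1 / real (card B)) * (\<Sum>b\<in>B. measure M (tau R b -` E)))"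

definition is_attractor :: "int \<Rightarrow> int set \<Rightarrow> real set \<Rightarrow> bool" where
  "is_attractor R B X \<longleftrightarrow> compact X \<and> X \<noteq> {} \<and> X = (\<Union>b\<in>B. tau R b ` X)"

definition no_overlap :: "int \<Rightarrow> int set \<Rightarrow> real measure \<Rightarrow> real set \<Rightarrow> bool" where
  "no_overlap R B M X \<longleftrightarrow>
     (\<forall>b\<in>B. \<forall>b'\<in>B. b \<noteq> b' \<longrightarrow> measure M (tau R b ` X \<inter> tau R b' ` X) = 0)"

definition expo :: "real \<Rightarrow> real \<Rightarrow> complex" where
  "expo lam x = cis (2 * pi * lam * x)"

definition cls :: "int \<Rightarrow> int set \<Rightarrow> int \<Rightarrow> int set" where
  "cls R B k = {k'. \<forall>b\<in>B. (of_int ((k' - k) * b) / of_int R :: real) \<in> \<int>}"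

definition Omega :: "int set \<Rightarrow> int list set" where
  "Omega L = {[]} \<union> {ws. ws \<noteq> [] \<and> set ws \<subseteq> L \<and> last ws \<noteq> 0}"

definition word_freq :: "int \<Rightarrow> int list \<Rightarrow> int" where
  "word_freq R ws = (\<Sum>i<length ws. R ^ i * ws ! i)"

definition word_weight :: "(int \<Rightarrow> complex) \<Rightarrow> int list \<Rightarrow> complex" where
  "word_weight \<alpha> ws = (\<Prod>i<length ws. \<alpha> (ws ! i))"

definition L2 :: "'a measure \<Rightarrow> ('a \<Rightarrow> complex) set" where
  "L2 M = {f. f \<in> borel_measurable M \<and> integrable M (\<lambda>x. (norm (f x))\<^sup>2)}"

definition L2_inner :: "'a measure \<Rightarrow> ('a \<Rightarrow> complex) \<Rightarrow> ('a \<Rightarrow> complex) \<Rightarrow> complex" where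
  "L2_inner M f g = (LINT x|M. f x * cnj (g x))"

definition L2_norm_sq :: "'a measure \<Rightarrow> ('a \<Rightarrow> complex) \<Rightarrow> real" where
  "L2_norm_sq M f = (LINT x|M. (norm (f x))\<^sup>2)"

definition parseval_frame :: "'a measure \<Rightarrow> ('i \<Rightarrow> 'a \<Rightarrow> complex) \<Rightarrow> 'i set \<Rightarrow> bool" where
  "parseval_frame M F I \<longleftrightarrow> (\<forall>i\<in>I. F i \<in> L2 M) \<and>
     (\<forall>f\<in>L2 M. ((\<lambda>i. (norm (L2_inner M f (F i)))\<^sup>2) has_sum L2_norm_sq M f) I)"

end

theory Submission
  imports Defs "HOL-Complex_Analysis.Complex_Analysis"
begin

text \<open>
  Write \<open>F\<^sub>w\<close> for the weighted exponential of the word \<open>w\<close> and let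
  \<open>Q f = \<parallel>f\<parallel>\<^sup>2 - \<Sum>\<^sub>w \<bar>\<langle>f, F\<^sub>w\<rangle>\<bar>\<^sup>2\<close>. Invariance of \<open>\<mu>\<close> gives operators \<open>T\<^sub>l\<close> with
  \<open>\<langle>f, F\<^bsub>l w\<^esub>\<rangle> = cnj \<alpha>\<^sub>l \<langle>T\<^sub>l f, F\<^sub>w\<rangle>\<close>, and the orthonormality of the columns gives
  \<open>\<Sum>\<^sub>l \<bar>\<alpha>\<^sub>l\<bar>\<^sup>2 \<parallel>T\<^sub>l f\<parallel>\<^sup>2 = \<parallel>f\<parallel>\<^sup>2\<close>. Hence \<open>Q \<ge> 0\<close> (Bessel), and \<open>Q f = \<Sum>\<^sub>l \<bar>\<alpha>\<^sub>l\<bar>\<^sup>2 Q (T\<^sub>l f)\<close>.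
  As \<open>T\<^sub>l e\<^sub>t\<close> is a multiple of \<open>e\<^sub>s\<close> with \<open>s = (t - l) / R\<close>, the function \<open>q t = Q e\<^sub>t\<close> is harmonic
  for a random walk that moves from \<open>t\<close> to points \<open>(t - l) / R\<close>.

  The function \<open>q\<close> is the restriction of an entire function and \<open>q 0 = 0\<close>. If its maximum on a large
  interval were positive, it would be attained on a finite set invariant under the walk. All points of
  a minimal invariant subset are periodic, hence rational with denominator prime to \<open>R\<close>; so two digits
  usable at the same point are congruent modulo \<open>R\<close>. The hypothesis on the classes \<open>[l]\<close> then leaves only
  the digit \<open>0\<close>, and the subset is \<open>{0}\<close>, a contradiction. Thus \<open>Q\<close> vanishes on all exponentials, and
  since it is a nonnegative quadratic form dominated by the norm, its zeros form a closed subspace,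
  which is all of \<open>L\<^sup>2(\<mu>)\<close> because \<open>\<mu>\<close> has bounded support.
\<close>

section \<open>Finite invariant sets\<close>

text \<open>In a minimal nonempty closed subset, the strict forward orbit of any point is again
  nonempty and closed, so it is the whole subset. In particular every point lies on its own orbit,
  which is the recurrence needed below.\<close>

lemma minimal_closed_subset:
  fixes S :: "('a \<times> 'a) set"
  assumes "finite A" "A \<noteq> {}" "S `` A \<subseteq> A" "\<And>x. x \<in> A \<Longrightarrow> S `` {x} \<noteq> {}"
  obtains C where "C \<subseteq> A" "C \<noteq> {}" "S `` C \<subseteq> C" "\<And>x. x \<in> C \<Longrightarrow> S\<^sup>+ `` {x} = C"
proof -
  define \<C> where "\<C> = {C. C \<subseteq> A \<and> C \<noteq> {} \<and> S `` C \<subseteq> C}"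
  have "finite \<C>" "\<C> \<noteq> {}"
    using assms unfolding \<C>_def by auto
  then obtain C where C: "C \<in> \<C>" and min: "\<And>D. D \<in> \<C> \<Longrightarrow> D \<subseteq> C \<Longrightarrow> C = D"
    by (meson finite_has_minimal)
  have "S\<^sup>+ `` {x} = C" if x: "x \<in> C" for x
  proof -
    have sub: "S\<^sup>+ `` {x} \<subseteq> C"
    proof
      fix y assume "y \<in> S\<^sup>+ `` {x}"
      then have "(x, y) \<in> S\<^sup>+" by simp
      then show "y \<in> C"
        by (induction rule: trancl_induct) (use C x in \<open>auto simp: \<C>_def\<close>)
    qed
    moreover have "S\<^sup>+ `` {x} \<noteq> {}"
      using assms(4)[of x] C x unfolding \<C>_def by blast
    moreover have "S `` (S\<^sup>+ `` {x}) \<subseteq> S\<^sup>+ `` {x}"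
      by (auto intro: trancl_into_trancl)
    ultimately show ?thesis
      using min[of "S\<^sup>+ `` {x}"] C unfolding \<C>_def by auto
  qed
  with C that show thesis unfolding \<C>_def by blast
qed

text \<open>\<open>G\<close> stands for the admissible targets of the walk, later the points where
  the mask does not vanish. On a minimal closed subset all points are periodic, so their
  denominators are prime to \<open>R\<close>. Two digits admissible at one point are then congruent
  modulo \<open>R\<close>, and \<open>branch\<close> rules out every nonzero digit.\<close>

lemma finite_invariant_set_contains_zero:
  fixes R :: int and L :: "int set" and A G :: "real set"
  assumes R: "\<bar>R\<bar> \<ge> 2" and A: "finite A" "A \<noteq> {}"
    and successor: "\<And>x. x \<in> A \<Longrightarrow> \<exists>l\<in>L. (x - of_int l) / of_int R \<in> G"
    and invariant: "\<And>x l. x \<in> A \<Longrightarrow> l \<in> L \<Longrightarrow> (x - of_int l) / of_int R \<in> G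
                      \<Longrightarrow> (x - of_int l) / of_int R \<in> A"
    and branch: "\<And>x l. x \<in> A \<Longrightarrow> l \<in> L \<Longrightarrow> l \<noteq> 0 \<Longrightarrow> (x - of_int l) / of_int R \<in> G
                      \<Longrightarrow> \<exists>l'\<in>L. (x - of_int l') / of_int R \<in> G \<and> \<not> [l' = l] (mod R)"
  shows "0 \<in> A"
proof -
  define S where "S = {(x, y). x \<in> A \<and> (\<exists>l\<in>L. y = (x - of_int l) / of_int R \<and> y \<in> G)}"
  have "S `` A \<subseteq> A"
    using invariant unfolding S_def by blast
  moreover have "S `` {x} \<noteq> {}" if "x \<in> A" for x
    using successor[OF that] that unfolding S_def by blast
  ultimately obtain C where C: "C \<subseteq> A" "C \<noteq> {}" "S `` C \<subseteq> C"
    and orbit: "\<And>x. x \<in> C \<Longrightarrow> S\<^sup>+ `` {x} = C"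
    using minimal_closed_subset[OF A] by metis
  have R0: "real_of_int R \<noteq> 0" using R by auto
  have Rn: "R ^ n \<noteq> 1" if "n > 0" for n
  proof
    assume "R ^ n = 1"
    then have "\<bar>R\<bar> ^ n = 1" by (metis abs_1 power_abs)
    moreover have "1 < \<bar>R\<bar> ^ n" using R that by (intro one_less_power) auto
    ultimately show False by simp
  qed
  \<comment> \<open>Reading the walk backwards, each step is the integral affine map
    \<open>y \<mapsto> R y + l\<close>; a composition of such maps has the form
    \<open>R ^ n * y + k\<close>.\<close>
  have path: "\<exists>n>0. \<exists>k::int. x = of_int R ^ n * y + of_int k" if "(x, y) \<in> S\<^sup>+" for x y
    using that
  proof (induction rule: trancl_induct)
    case (base y)
    then obtain l where "y = (x - of_int l) / of_int R" unfolding S_def by blast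
    then have "x = of_int R ^ 1 * y + of_int l" using R0 by (simp add: field_simps)
    then show ?case by blast
  next
    case (step y z)
    then obtain n k where n: "n > 0" "x = of_int R ^ n * y + of_int k" by blast
    from step obtain l where "z = (y - of_int l) / of_int R" unfolding S_def by blast
    then have "y = of_int R * z + of_int l" using R0 by (simp add: field_simps)
    then have "x = of_int R ^ Suc n * z + of_int (R ^ n * l + k)"
      using n by (simp add: algebra_simps)
    then show ?case by blast
  qed
  have periodic: "\<exists>n>0. (of_int R ^ n - 1) * x \<in> \<int>" if "x \<in> C" for x
  proof -
    have "(x, x) \<in> S\<^sup>+" using orbit[OF that] that by blast
    then obtain n k where "n > 0" "x = of_int R ^ n * x + of_int k" using path by blast
    then have "(of_int R ^ n - 1) * x = of_int (- k)" by (simp add: algebra_simps)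
    with \<open>n > 0\<close> show ?thesis using Ints_of_int by metis
  qed
  \<comment> \<open>Replacing a period by a multiple gives two periodic points a common
    period.\<close>
  have period_mult: "(of_int R ^ (n * m) - 1) * x \<in> \<int>"
    if "(of_int R ^ n - 1) * x \<in> \<int>" for n m and x :: real
  proof -
    have "(R ^ n - 1) dvd (R ^ n) ^ m - 1"
      using power_diff_1_eq[of "R ^ n" m] by simp
    then obtain j where "(R ^ n) ^ m - 1 = (R ^ n - 1) * j" by blast
    then have "real_of_int ((R ^ n) ^ m - 1) = real_of_int ((R ^ n - 1) * j)" by simp
    then have "of_int R ^ (n * m) - 1 = (of_int R ^ n - 1) * real_of_int j"
      by (simp add: power_mult)
    then have "(of_int R ^ (n * m) - 1) * x = of_int j * ((of_int R ^ n - 1) * x)"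
      by simp
    then show ?thesis using that by (metis Ints_mult Ints_of_int)
  qed
  have zero_digit: "l = 0" if x: "x \<in> C" and l: "l \<in> L" "(x - of_int l) / of_int R \<in> G" for x l
  proof (rule ccontr)
    assume "l \<noteq> 0"
    then obtain l' where l': "l' \<in> L" "(x - of_int l') / of_int R \<in> G" "\<not> [l' = l] (mod R)"
      using branch[of x l] x C l by blast
    define y y' where "y = (x - of_int l) / of_int R" and "y' = (x - of_int l') / of_int R"
    have "y \<in> C" "y' \<in> C"
      using x l l' C unfolding S_def y_def y'_def by blast+
    then obtain n m where nm: "n > 0" "m > 0" "(of_int R ^ n - 1) * y \<in> \<int>" "(of_int R ^ m - 1) * y' \<in> \<int>"
      using periodic by metis
    \<comment> \<open>The common factor \<open>R ^ (n * m) - 1\<close> is prime to \<open>R\<close>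
      and clears the denominators of both successors, while \<open>R * (y - y')\<close> is already
      the integer \<open>l' - l\<close>. Comparing the two yields
      \<open>R dvd l' - l\<close>.\<close>
    have "(of_int R ^ (n * m) - 1) * y - (of_int R ^ (m * n) - 1) * y' \<in> \<int>"
      using nm by (intro Ints_diff period_mult)
    then obtain j where j: "(of_int R ^ (n * m) - 1) * (y - y') = of_int j"
      by (auto simp: Ints_def algebra_simps)
    have diff: "of_int R * (y - y') = of_int (l' - l)"
      using R0 by (simp add: y_def y'_def field_simps)
    have "real_of_int (R * j) = of_int R * ((of_int R ^ (n * m) - 1) * (y - y'))"
      by (simp add: j)
    also have "\<dots> = (of_int R ^ (n * m) - 1) * (of_int R * (y - y'))"
      by (simp only: mult.left_commute)
    also have "\<dots> = of_int ((R ^ (n * m) - 1) * (l' - l))"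
      by (simp add: diff)
    finally have "R * j = (R ^ (n * m) - 1) * (l' - l)"
      by (simp only: of_int_eq_iff)
    then have "R dvd (R ^ (n * m) - 1) * (l' - l)"
      by (metis dvd_triv_left)
    moreover have "coprime R (R ^ (n * m) - 1)"
    proof -
      have "n * m > 0" using nm by simp
      moreover have "coprime (R ^ (n * m) - 1) (R ^ (n * m))"
        by (rule coprime_diff_one_left)
      ultimately show ?thesis
        by (simp only: coprime_power_right_iff coprime_commute[of R]) simp
    qed
    ultimately have "R dvd l' - l"
      using coprime_dvd_mult_right_iff by blast
    then show False using l'(3) by (simp add: cong_iff_dvd_diff)
  qed
  obtain x where x: "x \<in> C" using C by blast
  \<comment> \<open>With only the digit 0 left, each step divides by \<open>R\<close>, so a return
    to \<open>x\<close> forces \<open>x = R ^ n * x\<close> and hence \<open>x = 0\<close>.\<close>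
  have "y \<in> C \<and> (\<exists>n>0. x = of_int R ^ n * y)" if "(x, y) \<in> S\<^sup>+" for y
    using that
  proof (induction rule: trancl_induct)
    case (base y)
    then obtain l where l: "y = (x - of_int l) / of_int R" "l \<in> L" "y \<in> G" unfolding S_def by blast
    then have "l = 0" using zero_digit x by blast
    then have "x = of_int R ^ 1 * y" using R0 l by (simp add: field_simps)
    then show ?case using base x C by blast
  next
    case (step y z)
    then obtain n where n: "n > 0" "x = of_int R ^ n * y" by blast
    from step obtain l where l: "z = (y - of_int l) / of_int R" "l \<in> L" "z \<in> G"
      unfolding S_def by blast
    then have "l = 0" using zero_digit step by blast
    then have "y = of_int R * z" using R0 l by (simp add: field_simps)
    then have "x = of_int R ^ Suc n * z" using n by simp
    then show ?case using step C by blast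
  qed
  moreover have "(x, x) \<in> S\<^sup>+" using orbit[OF x] x by blast
  ultimately obtain n where n: "n > 0" "x = of_int R ^ n * x" by blast
  then have "of_int (R ^ n - 1) * x = 0" by (simp add: algebra_simps)
  then have "x = 0" using Rn[OF n(1)] by (metis eq_iff_diff_eq_0 mult_eq_0_iff of_int_eq_0_iff)
  then show ?thesis using x C by blast
qed

section \<open>Bessel systems\<close>

lemma norm_add_square_le: "(norm (a + b))\<^sup>2 \<le> 2 * (norm a)\<^sup>2 + 2 * (norm b)\<^sup>2"
  for a b :: "'a::real_normed_vector"
proof -
  have "(norm (a + b))\<^sup>2 \<le> (norm a + norm b)\<^sup>2"
    by (intro power_mono norm_triangle_ineq) auto
  also have "\<dots> \<le> 2 * (norm a)\<^sup>2 + 2 * (norm b)\<^sup>2"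
    using zero_le_power2[of "norm a - norm b"] by (simp add: power2_eq_square algebra_simps)
  finally show ?thesis .
qed

lemma L2_measurable: "f \<in> L2 M \<Longrightarrow> f \<in> borel_measurable M"
  by (simp add: L2_def)

lemma L2_add:
  assumes "f \<in> L2 M" "g \<in> L2 M"
  shows "(\<lambda>x. f x + g x) \<in> L2 M"
proof -
  have "integrable M (\<lambda>x. (norm (f x + g x))\<^sup>2)"
    by (rule Bochner_Integration.integrable_bound[where f = "\<lambda>x. 2 * (norm (f x))\<^sup>2 + 2 * (norm (g x))\<^sup>2"])
       (use assms norm_add_square_le in \<open>auto simp: L2_def\<close>)
  then show ?thesis using assms by (auto simp: L2_def)
qed

lemma L2_scale: "f \<in> L2 M \<Longrightarrow> (\<lambda>x. c * f x) \<in> L2 M"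
  by (auto simp: L2_def norm_mult power_mult_distrib)

lemma L2_diff:
  assumes "f \<in> L2 M" "g \<in> L2 M"
  shows "(\<lambda>x. f x - g x) \<in> L2 M"
  using L2_add[OF assms(1) L2_scale[OF assms(2), of "-1"]] by simp

lemma L2_sum: "finite S \<Longrightarrow> (\<And>i. i \<in> S \<Longrightarrow> f i \<in> L2 M) \<Longrightarrow> (\<lambda>x. \<Sum>i\<in>S. f i x) \<in> L2 M"
proof (induction S rule: finite_induct)
  case empty
  then show ?case by (simp add: L2_def)
next
  case (insert i S)
  then show ?case by (simp add: L2_add)
qed

lemma L2_mult_integrable:
  assumes "f \<in> L2 M" "g \<in> L2 M"
  shows "integrable M (\<lambda>x. f x * cnj (g x))"
proof (rule Bochner_Integration.integrable_bound[where f = "\<lambda>x. (norm (f x))\<^sup>2 + (norm (g x))\<^sup>2"])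
  have "norm (f x) * norm (g x) \<le> (norm (f x))\<^sup>2 + (norm (g x))\<^sup>2" for x
  proof -
    have "2 * (norm (f x) * norm (g x)) \<le> (norm (f x))\<^sup>2 + (norm (g x))\<^sup>2"
      using sum_squares_bound[of "norm (f x)" "norm (g x)"] by simp
    moreover have "0 \<le> norm (f x) * norm (g x)" by simp
    ultimately show ?thesis by linarith
  qed
  then show "AE x in M. norm (f x * cnj (g x)) \<le> norm ((norm (f x))\<^sup>2 + (norm (g x))\<^sup>2)"
    by (simp add: norm_mult)
qed (use assms in \<open>auto simp: L2_def intro!: borel_measurable_times borel_measurable_continuous_on[OF continuous_on_cnj[OF continuous_on_id]]\<close>)

lemma L2_inner_scale: "L2_inner M (\<lambda>x. c * f x) g = c * L2_inner M f g"
  by (simp add: L2_inner_def mult.assoc)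

lemma L2_norm_sq_scale: "L2_norm_sq M (\<lambda>x. c * f x) = (norm c)\<^sup>2 * L2_norm_sq M f"
  by (simp add: L2_norm_sq_def norm_mult power_mult_distrib)

lemma L2_inner_add:
  assumes "f \<in> L2 M" "g \<in> L2 M" "h \<in> L2 M"
  shows "L2_inner M (\<lambda>x. f x + g x) h = L2_inner M f h + L2_inner M g h"
  using assms by (simp add: L2_inner_def distrib_right L2_mult_integrable)

lemma L2_inner_diff:
  assumes "f \<in> L2 M" "g \<in> L2 M" "h \<in> L2 M"
  shows "L2_inner M (\<lambda>x. f x - g x) h = L2_inner M f h - L2_inner M g h"
  using assms by (simp add: L2_inner_def left_diff_distrib L2_mult_integrable)

lemma complex_parallelogram:
  "(norm (a + b))\<^sup>2 + (norm (a - b))\<^sup>2 = 2 * (norm a)\<^sup>2 + 2 * (norm b)\<^sup>2" for a b :: complex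
  unfolding cmod_power2 by (simp add: power2_eq_square algebra_simps)

lemma L2_parallelogram:
  assumes "f \<in> L2 M" "g \<in> L2 M"
  shows "L2_norm_sq M (\<lambda>x. f x + g x) + L2_norm_sq M (\<lambda>x. f x - g x)
           = 2 * L2_norm_sq M f + 2 * L2_norm_sq M g"
proof -
  have i: "integrable M (\<lambda>x. (norm (f x + g x))\<^sup>2)" "integrable M (\<lambda>x. (norm (f x - g x))\<^sup>2)"
    "integrable M (\<lambda>x. (norm (f x))\<^sup>2)" "integrable M (\<lambda>x. (norm (g x))\<^sup>2)"
    using L2_add[OF assms] L2_diff[OF assms] assms by (auto simp: L2_def)
  have "L2_norm_sq M (\<lambda>x. f x + g x) + L2_norm_sq M (\<lambda>x. f x - g x)
      = (LINT x|M. (norm (f x + g x))\<^sup>2 + (norm (f x - g x))\<^sup>2)"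
    unfolding L2_norm_sq_def using i by (intro Bochner_Integration.integral_add[symmetric])
  also have "\<dots> = (LINT x|M. 2 * (norm (f x))\<^sup>2 + 2 * (norm (g x))\<^sup>2)"
    by (simp add: complex_parallelogram)
  also have "\<dots> = 2 * L2_norm_sq M f + 2 * L2_norm_sq M g"
    unfolding L2_norm_sq_def using i by simp
  finally show ?thesis .
qed

section \<open>The defect of a Bessel system as a nonnegative quadratic form\<close>

locale bessel_system =
  fixes M :: "'a measure" and F :: "'i \<Rightarrow> 'a \<Rightarrow> complex" and I :: "'i set"
  assumes F_L2: "i \<in> I \<Longrightarrow> F i \<in> L2 M"
    and bessel: "f \<in> L2 M \<Longrightarrow> finite S \<Longrightarrow> S \<subseteq> I
                   \<Longrightarrow> (\<Sum>i\<in>S. (norm (L2_inner M f (F i)))\<^sup>2) \<le> L2_norm_sq M f"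
begin

definition energy :: "('a \<Rightarrow> complex) \<Rightarrow> real" where
  "energy f = (\<Sum>\<^sub>\<infinity>i\<in>I. (norm (L2_inner M f (F i)))\<^sup>2)"

definition defect :: "('a \<Rightarrow> complex) \<Rightarrow> real" where
  "defect f = L2_norm_sq M f - energy f"

lemma energy_summable:
  assumes "f \<in> L2 M"
  shows "(\<lambda>i. (norm (L2_inner M f (F i)))\<^sup>2) summable_on I"
  by (rule nonneg_bdd_above_summable_on) (auto intro!: bdd_aboveI2[where M = "L2_norm_sq M f"] bessel assms)

lemma energy_has_sum:
  assumes "f \<in> L2 M"
  shows "((\<lambda>i. (norm (L2_inner M f (F i)))\<^sup>2) has_sum energy f) I"
  unfolding energy_def using energy_summable[OF assms] by (rule has_sum_infsum)

lemma energy_nonneg: "0 \<le> energy f"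
  unfolding energy_def by (intro infsum_nonneg) simp

lemma defect_nonneg:
  assumes "f \<in> L2 M"
  shows "0 \<le> defect f"
proof -
  have "energy f \<le> L2_norm_sq M f"
    unfolding energy_def by (intro infsum_le_finite_sums energy_summable bessel assms)
  then show ?thesis by (simp add: defect_def)
qed

lemma defect_le: "defect f \<le> L2_norm_sq M f"
  by (simp add: defect_def energy_nonneg)

lemma energy_scale: "energy (\<lambda>x. c * f x) = (norm c)\<^sup>2 * energy f"
  by (simp add: energy_def L2_inner_scale norm_mult power_mult_distrib infsum_cmult_right')

lemma defect_scale: "defect (\<lambda>x. c * f x) = (norm c)\<^sup>2 * defect f"
  by (simp add: defect_def energy_scale L2_norm_sq_scale algebra_simps)

text \<open>Norm and energy both satisfy the parallelogram law, hence so does their difference. This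
  law and nonnegativity suffice to show that the zeros of \<open>defect\<close> form a closed
  subspace; no polarised form is required.\<close>

lemma defect_parallelogram:
  assumes "f \<in> L2 M" "g \<in> L2 M"
  shows "defect (\<lambda>x. f x + g x) + defect (\<lambda>x. f x - g x) = 2 * defect f + 2 * defect g"
proof -
  have "energy (\<lambda>x. f x + g x) + energy (\<lambda>x. f x - g x)
      = (\<Sum>\<^sub>\<infinity>i\<in>I. (norm (L2_inner M (\<lambda>x. f x + g x) (F i)))\<^sup>2 + (norm (L2_inner M (\<lambda>x. f x - g x) (F i)))\<^sup>2)"
    unfolding energy_def using assms
    by (intro infsum_add[symmetric] energy_summable L2_add L2_diff)
  also have "\<dots> = (\<Sum>\<^sub>\<infinity>i\<in>I. 2 * (norm (L2_inner M f (F i)))\<^sup>2 + 2 * (norm (L2_inner M g (F i)))\<^sup>2)"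
    by (intro infsum_cong) (simp add: L2_inner_add L2_inner_diff F_L2 assms complex_parallelogram)
  also have "\<dots> = 2 * energy f + 2 * energy g"
    unfolding energy_def using assms
    by (simp add: infsum_add energy_summable summable_on_cmult_right infsum_cmult_right')
  finally show ?thesis
    using L2_parallelogram[OF assms] by (simp add: defect_def)
qed

lemma defect_zero_add:
  assumes "f \<in> L2 M" "g \<in> L2 M" "defect f = 0" "defect g = 0"
  shows "defect (\<lambda>x. f x + g x) = 0"
  \<comment> \<open>Two nonnegative numbers with sum 0 both vanish.\<close>
  using defect_parallelogram[OF assms(1,2)] assms defect_nonneg[OF L2_add[OF assms(1,2)]]
    defect_nonneg[OF L2_diff[OF assms(1,2)]] by linarith

lemma defect_zero_scale: "defect f = 0 \<Longrightarrow> defect (\<lambda>x. c * f x) = 0"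
  by (simp add: defect_scale)

lemma defect_zero_diff:
  assumes "f \<in> L2 M" "g \<in> L2 M" "defect f = 0" "defect g = 0"
  shows "defect (\<lambda>x. f x - g x) = 0"
  using defect_parallelogram[OF assms(1,2)] assms defect_nonneg[OF L2_add[OF assms(1,2)]]
    defect_nonneg[OF L2_diff[OF assms(1,2)]] by linarith

lemma defect_zero_sum:
  "finite S \<Longrightarrow> (\<And>i. i \<in> S \<Longrightarrow> f i \<in> L2 M \<and> defect (f i) = 0) \<Longrightarrow> defect (\<lambda>x. \<Sum>i\<in>S. f i x) = 0"
proof (induction S rule: finite_induct)
  case empty
  then show ?case by (simp add: defect_def energy_def L2_norm_sq_def L2_inner_def)
next
  case (insert i S)
  then show ?case using defect_zero_add[of "f i" "\<lambda>x. \<Sum>i\<in>S. f i x"] L2_sum[of S f] by simp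
qed

text \<open>Closedness of the zero set: the parallelogram law for \<open>f = (f - g) + g\<close>
  bounds \<open>defect f\<close> by twice \<open>defect (f - g)\<close>, and the defect is at most
  the squared norm.\<close>

lemma defect_zero_approx:
  assumes f: "f \<in> L2 M"
    and approx: "\<And>e. e > 0 \<Longrightarrow> \<exists>g\<in>L2 M. defect g = 0 \<and> L2_norm_sq M (\<lambda>x. f x - g x) \<le> e"
  shows "defect f = 0"
proof -
  have "defect f \<le> 0 + e" if e: "e > 0" for e
  proof -
    obtain g where g: "g \<in> L2 M" "defect g = 0" "L2_norm_sq M (\<lambda>x. f x - g x) \<le> e / 2"
      using approx[of "e / 2"] e by auto
    have d: "(\<lambda>x. f x - g x) \<in> L2 M" using f g by (intro L2_diff)
    have "defect f = defect (\<lambda>x. (f x - g x) + g x)" by simp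
    also have "\<dots> \<le> 2 * defect (\<lambda>x. f x - g x) + 2 * defect g"
      using defect_parallelogram[OF d g(1)] defect_nonneg[OF L2_diff[OF d g(1)]] by linarith
    also have "\<dots> \<le> e" using g defect_le[of "\<lambda>x. f x - g x"] by simp
    finally show ?thesis by simp
  qed
  then have "defect f \<le> 0" by (rule field_le_epsilon)
  then show ?thesis using defect_nonneg[OF f] by simp
qed

lemma defect_zero_limit:
  assumes f: "f \<in> L2 M" and g: "\<And>n. g n \<in> L2 M" "\<And>n. defect (g n) = 0"
    and lim: "(\<lambda>n. L2_norm_sq M (\<lambda>x. f x - g n x)) \<longlonglongrightarrow> 0"
  shows "defect f = 0"
proof (rule defect_zero_approx[OF f])
  fix e :: real assume "e > 0"
  then have "\<forall>\<^sub>F n in sequentially. L2_norm_sq M (\<lambda>x. f x - g n x) < e"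
    using lim by (rule order_tendstoD[rotated])
  then obtain n where "L2_norm_sq M (\<lambda>x. f x - g n x) < e"
    by (auto simp: eventually_sequentially)
  then show "\<exists>g\<in>L2 M. defect g = 0 \<and> L2_norm_sq M (\<lambda>x. f x - g x) \<le> e"
    using g by (intro bexI[of _ "g n"]) auto
qed

lemma parseval_frameI:
  assumes "\<And>f. f \<in> L2 M \<Longrightarrow> defect f = 0"
  shows "parseval_frame M F I"
  unfolding parseval_frame_def using F_L2 energy_has_sum assms by (simp add: defect_def)

end

section \<open>Density of trigonometric polynomials\<close>

lemma expo_add: "expo s x * expo t x = expo (s + t) x"
  by (simp add: expo_def cis_mult algebra_simps)

lemma norm_expo [simp]: "norm (expo t x) = 1"
  by (simp add: expo_def)

lemma continuous_on_expo [continuous_intros]: "continuous_on S (expo t)"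
  unfolding expo_def by (intro continuous_intros)

text \<open>Arbitrary real frequencies are allowed, so that functions on an interval of any length
  can be approximated without a periodicity constraint.\<close>

inductive trig_poly :: "(real \<Rightarrow> complex) \<Rightarrow> bool" where
  monomial: "trig_poly (\<lambda>x. c * expo t x)"
| add: "trig_poly f \<Longrightarrow> trig_poly g \<Longrightarrow> trig_poly (\<lambda>x. f x + g x)"

lemma trig_poly_mult:
  assumes "trig_poly f" "trig_poly g"
  shows "trig_poly (\<lambda>x. f x * g x)"
  using assms
proof (induction arbitrary: g rule: trig_poly.induct)
  case (monomial c t)
  then show ?case
  proof (induction rule: trig_poly.induct)
    case (monomial c' t')
    have "(\<lambda>x. c * expo t x * (c' * expo t' x)) = (\<lambda>x. (c * c') * expo (t + t') x)"
      by (simp add: expo_add[symmetric] algebra_simps)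
    then show ?case by (simp add: trig_poly.monomial)
  next
    case (add f g)
    then show ?case by (simp add: trig_poly.add distrib_left)
  qed
next
  case (add f h)
  then show ?case by (simp add: trig_poly.add distrib_right)
qed

lemma trig_poly_const: "trig_poly (\<lambda>x. c)"
  using trig_poly.monomial[of c 0] by (simp add: expo_def)

lemma trig_poly_sin: "trig_poly (\<lambda>x. of_real (sin (2 * pi * t * x)))"
proof -
  have "(\<lambda>x. complex_of_real (sin (2 * pi * t * x)))
      = (\<lambda>x. (- \<i> / 2) * expo t x + (\<i> / 2) * expo (- t) x)"
    by (rule ext) (simp add: expo_def complex_eq_iff)
  then show ?thesis by (simp only: trig_poly.intros)
qed

lemma trig_poly_continuous: "trig_poly f \<Longrightarrow> continuous_on S f"
  by (induction rule: trig_poly.induct) (auto intro!: continuous_intros)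

text \<open>Real Stone-Weierstrass, applied to the algebra of real functions whose complexification
  is a trigonometric polynomial.\<close>

lemma trig_poly_approx:
  fixes f :: "real \<Rightarrow> real"
  assumes f: "continuous_on {-C..C} f" and e: "e > 0"
  obtains g where "trig_poly (\<lambda>x. of_real (g x))" "\<And>x. x \<in> {-C..C} \<Longrightarrow> \<bar>f x - g x\<bar> < e"
proof -
  have "\<exists>g. trig_poly (\<lambda>x. complex_of_real (g x)) \<and> (\<forall>x\<in>{-C..C}. \<bar>f x - g x\<bar> < e)"
  proof (rule Stone_Weierstrass_HOL)
    fix g :: "real \<Rightarrow> real" assume "trig_poly (\<lambda>x. complex_of_real (g x))"
    then have "continuous_on {-C..C} (\<lambda>x. Re (complex_of_real (g x)))"
      by (intro continuous_intros trig_poly_continuous)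
    then show "continuous_on {-C..C} g" by simp
  next
    fix x y assume xy: "x \<in> {-C..C} \<and> y \<in> {-C..C} \<and> x \<noteq> y"
    \<comment> \<open>The frequency is so low that \<open>2 * pi * t * z\<close> stays within a
      quarter turn of 0 on the whole interval, where the sine is injective. Adding 1 to
      \<open>C\<close> avoids division by 0 when \<open>C = 0\<close>.\<close>
    define t where "t = 1 / (4 * (C + 1))"
    have C: "C \<ge> 0" using xy by auto
    then have t: "t > 0" by (simp add: t_def)
    have range: "- (pi / 2) \<le> 2 * pi * t * z \<and> 2 * pi * t * z \<le> pi / 2" if "z \<in> {-C..C}" for z
    proof -
      have "t * \<bar>z\<bar> \<le> 1 / 4" using that C by (auto simp: t_def field_simps abs_le_iff)
      then have "\<bar>t * z\<bar> \<le> 1 / 4" using t by (simp add: abs_mult)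
      then have "2 * pi * \<bar>t * z\<bar> \<le> 2 * pi * (1 / 4)"
        by (intro mult_left_mono) auto
      then have "\<bar>2 * pi * (t * z)\<bar> \<le> pi / 2"
        by (simp add: abs_mult)
      then show ?thesis unfolding abs_le_iff mult.assoc by linarith
    qed
    have "sin (2 * pi * t * x) \<noteq> sin (2 * pi * t * y)"
    proof
      assume eq: "sin (2 * pi * t * x) = sin (2 * pi * t * y)"
      have "2 * pi * t * x = 2 * pi * t * y"
        using range xy by (intro sin_inj_pi[OF _ _ _ _ eq]) blast+
      then show False using t xy by simp
    qed
    then show "\<exists>f. trig_poly (\<lambda>x. complex_of_real (f x)) \<and> f x \<noteq> f y"
      using trig_poly_sin by (intro exI[of _ "\<lambda>x. sin (2 * pi * t * x)"]) auto
  qed (simp_all add: f e trig_poly_const trig_poly_mult trig_poly.add)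
  then show thesis using that by blast
qed

context bessel_system
begin

text \<open>Dominated convergence turns a pointwise limit under a square-integrable majorant into a
  limit in norm. It serves for closed sets, disjoint unions and simple functions alike.\<close>

lemma defect_zero_dominated:
  fixes w :: "'a \<Rightarrow> real"
  assumes f: "f \<in> borel_measurable M" and w: "w \<in> borel_measurable M" "integrable M (\<lambda>x. (w x)\<^sup>2)"
    and bound: "\<And>x. norm (f x) \<le> w x" "\<And>n x. norm (g n x) \<le> w x"
    and g: "\<And>n. g n \<in> L2 M" "\<And>n. defect (g n) = 0"
    and lim: "\<And>x. (\<lambda>n. g n x) \<longlonglongrightarrow> f x"
  shows "defect f = 0"
proof -
  have fL: "f \<in> L2 M"
  proof -
    have "integrable M (\<lambda>x. (norm (f x))\<^sup>2)"
      by (rule Bochner_Integration.integrable_bound[OF w(2)])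
         (use f bound in \<open>auto intro!: power_mono\<close>)
    then show ?thesis using f by (simp add: L2_def)
  qed
  have "(\<lambda>n. LINT x|M. (norm (f x - g n x))\<^sup>2) \<longlonglongrightarrow> (LINT x|M. 0)"
  proof (rule integral_dominated_convergence[where w = "\<lambda>x. 4 * (w x)\<^sup>2"])
    show "AE x in M. (\<lambda>n. (norm (f x - g n x))\<^sup>2) \<longlonglongrightarrow> 0"
      by (auto intro!: AE_I2 tendsto_eq_intros lim)
    fix n
    show "AE x in M. norm ((norm (f x - g n x))\<^sup>2) \<le> 4 * (w x)\<^sup>2"
    proof (rule AE_I2)
      fix x
      have "norm (f x - g n x) \<le> 2 * w x"
        using norm_triangle_ineq4[of "f x" "g n x"] bound(1)[of x] bound(2)[of n x] by linarith
      then have "(norm (f x - g n x))\<^sup>2 \<le> (2 * w x)\<^sup>2" by (intro power_mono) auto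
      then show "norm ((norm (f x - g n x))\<^sup>2) \<le> 4 * (w x)\<^sup>2" by (simp add: power_mult_distrib)
    qed
    show "(\<lambda>x. (norm (f x - g n x))\<^sup>2) \<in> borel_measurable M"
      using L2_measurable[OF L2_diff[OF fL g(1)]] by measurable
  qed (use w in auto)
  then have "(\<lambda>n. L2_norm_sq M (\<lambda>x. f x - g n x)) \<longlonglongrightarrow> 0"
    by (simp add: L2_norm_sq_def)
  then show ?thesis using defect_zero_limit fL g by blast
qed

end

lemma (in finite_measure) L2_bounded:
  assumes "f \<in> borel_measurable M" "AE x in M. norm (f x) \<le> K"
  shows "f \<in> L2 M"
proof -
  have "integrable M (\<lambda>x. (norm (f x))\<^sup>2)"
    by (rule integrable_const_bound[where B = "K\<^sup>2"])
       (use assms in \<open>auto elim!: eventually_mono intro!: power_mono\<close>)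
  then show ?thesis using assms by (simp add: L2_def)
qed

section \<open>From exponentials to all square-integrable functions on a bounded support\<close>

locale compact_bessel_system = bessel_system M F I
  for M :: "real measure" and F :: "'i \<Rightarrow> real \<Rightarrow> complex" and I :: "'i set" +
  fixes C :: real
  assumes prob: "prob_space M" and sets_M: "sets M = sets borel"
    and support: "AE x in M. \<bar>x\<bar> \<le> C"
    and expo_defect: "defect (expo t) = 0"
begin

interpretation prob_space M by (rule prob)

lemma space_M: "space M = UNIV"
  using sets_eq_imp_space_eq[OF sets_M] by simp

lemma measurable_M: "borel_measurable M = borel_measurable borel"
  by (rule measurable_cong_sets[OF sets_M refl])

lemma L2_continuous:
  fixes f :: "real \<Rightarrow> complex"
  assumes "continuous_on UNIV f"
  shows "f \<in> L2 M"
proof -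
  have "compact (f ` {-C..C})"
    using assms by (intro compact_continuous_image) (auto intro: continuous_on_subset)
  then have "bounded (f ` {-C..C})" by (rule compact_imp_bounded)
  then obtain K where "\<And>y. y \<in> f ` {-C..C} \<Longrightarrow> norm y \<le> K"
    unfolding bounded_iff by metis
  then have K: "norm (f x) \<le> K" if "x \<in> {-C..C}" for x
    using that by (metis imageI)
  have "AE x in M. norm (f x) \<le> K"
    using support by eventually_elim (simp add: K abs_le_iff minus_le_iff)
  then show ?thesis
    using assms by (intro L2_bounded) (auto simp: measurable_M intro: borel_measurable_continuous_onI)
qed

lemma defect_zero_trig_poly: "trig_poly f \<Longrightarrow> defect f = 0"
proof (induction rule: trig_poly.induct)
  case (monomial c t)
  then show ?case by (simp add: defect_zero_scale expo_defect)
next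
  case (add f g)
  then show ?case by (intro defect_zero_add L2_continuous trig_poly_continuous)
qed

text \<open>Uniform approximation on \<open>{-C..C}\<close> is enough, because this interval carries
  the measure. Precision \<open>sqrt e\<close> gives squared norm at most \<open>e\<close> since the
  total mass is 1.\<close>

lemma defect_zero_continuous:
  fixes f :: "real \<Rightarrow> real"
  assumes f: "continuous_on UNIV f"
  shows "defect (\<lambda>x. of_real (f x)) = 0"
proof (rule defect_zero_approx)
  show fL: "(\<lambda>x. complex_of_real (f x)) \<in> L2 M"
    using f by (intro L2_continuous continuous_intros)
  fix e :: real assume e: "e > 0"
  obtain g where g: "trig_poly (\<lambda>x. of_real (g x))" "\<And>x. x \<in> {-C..C} \<Longrightarrow> \<bar>f x - g x\<bar> < sqrt e"
    using trig_poly_approx[of C f "sqrt e"] e continuous_on_subset[OF f] by auto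
  have gL: "(\<lambda>x. complex_of_real (g x)) \<in> L2 M"
    using g by (intro L2_continuous trig_poly_continuous)
  have "L2_norm_sq M (\<lambda>x. of_real (f x) - of_real (g x)) \<le> (LINT x|M. e)"
    unfolding L2_norm_sq_def
  proof (rule integral_mono_AE)
    show "integrable M (\<lambda>x. (cmod (complex_of_real (f x) - complex_of_real (g x)))\<^sup>2)"
      using L2_diff[OF fL gL] by (simp add: L2_def)
    show "AE x in M. (cmod (complex_of_real (f x) - complex_of_real (g x)))\<^sup>2 \<le> e"
      using support
    proof eventually_elim
      case (elim x)
      then have "\<bar>f x - g x\<bar> \<le> sqrt e" using g(2)[of x] by (force simp: abs_le_iff)
      then have "\<bar>f x - g x\<bar>\<^sup>2 \<le> (sqrt e)\<^sup>2" by (intro power_mono) auto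
      then show ?case using e by (simp flip: of_real_diff)
    qed
  qed simp
  then show "\<exists>g\<in>L2 M. defect g = 0 \<and> L2_norm_sq M (\<lambda>x. of_real (f x) - g x) \<le> e"
    using gL defect_zero_trig_poly[OF g(1)] by (intro bexI[OF _ gL]) (simp add: prob_space)
qed

lemma L2_indicator: "A \<in> sets borel \<Longrightarrow> indicator A \<in> L2 M"
  by (intro L2_bounded[where K = 1]) (simp_all add: measurable_M, simp add: indicator_def)

lemma defect_zero_closed:
  assumes A: "closed A"
  shows "defect (indicator A) = 0"
\<comment> \<open>By convention \<open>infdist x {}\<close> is 0, so the tent functions below would
  converge to the constant 1 for the empty set.\<close>
proof (cases "A = {}")
  case True
  then have "indicator A = (\<lambda>x::real. 0 * expo 0 x)" by (simp add: fun_eq_iff)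
  then show ?thesis using defect_zero_scale[OF expo_defect] by metis
next
  case False
  \<comment> \<open>Tent functions equal to 1 on \<open>A\<close>; off the closed set
    \<open>A\<close> the distance is positive and they are eventually 0.\<close>
  define g where "g n x = max 0 (1 - real n * infdist x A)" for n :: nat and x :: real
  have g_cont: "continuous_on UNIV (g n)" for n
    unfolding g_def by (intro continuous_intros)
  have g_bound: "0 \<le> g n x" "g n x \<le> 1" for n x
    unfolding g_def using infdist_nonneg[of x A] by auto
  have lim: "(\<lambda>n. complex_of_real (g n x)) \<longlonglongrightarrow> indicator A x" for x
  proof (cases "x \<in> A")
    case True
    then show ?thesis by (simp add: g_def)
  next
    case x: False
    then have pos: "infdist x A > 0"
      using in_closed_iff_infdist_zero[OF A False, of x] infdist_nonneg[of x A] by linarith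
    obtain N where N: "1 / infdist x A < real N" using reals_Archimedean2 by blast
    have "g n x = 0" if "n \<ge> N" for n
    proof -
      have "1 < real N * infdist x A" using N pos by (simp add: field_simps)
      also have "\<dots> \<le> real n * infdist x A" using that pos by (intro mult_right_mono) auto
      finally show ?thesis by (simp add: g_def)
    qed
    then have "(\<lambda>n. complex_of_real (g n x)) \<longlonglongrightarrow> 0"
      by (intro tendsto_eventually) (auto simp: eventually_sequentially)
    then show ?thesis using x by simp
  qed
  show ?thesis
  proof (rule defect_zero_dominated[where w = "\<lambda>_. 1" and g = "\<lambda>n x. of_real (g n x)"])
    show "indicator A \<in> borel_measurable M"
      using A by (auto simp: measurable_M)
    show "(\<lambda>x. complex_of_real (g n x)) \<in> L2 M" for n
      using g_cont by (intro L2_continuous continuous_intros)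
    show "defect (\<lambda>x. complex_of_real (g n x)) = 0" for n
      by (intro defect_zero_continuous g_cont)
  qed (use g_bound lim in \<open>auto simp: indicator_def\<close>)
qed

text \<open>Dynkin's theorem with the closed sets as an intersection-stable generator. Complements
  use that the constant 1 is \<open>expo 0\<close>.\<close>

lemma defect_zero_indicator:
  assumes "A \<in> sets borel"
  shows "defect (indicator A) = 0"
proof -
  have "Int_stable {S. closed (S :: real set)}"
    by (auto simp: Int_stable_def)
  moreover have "{S. closed S} \<subseteq> Pow (UNIV :: real set)" by simp
  moreover have "A \<in> sigma_sets UNIV {S. closed S}"
    using assms by (simp add: borel_eq_closed)
  ultimately show ?thesis
  proof (induction rule: sigma_sets_induct_disjoint)
    case (basic A)
    then show ?case by (simp add: defect_zero_closed)
  next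
    case empty
    show ?case by (rule defect_zero_closed) simp
  next
    case (compl A)
    then have "A \<in> sets borel" by (simp add: borel_eq_closed)
    then have "defect (\<lambda>x. expo 0 x - indicator A x) = 0"
      using compl expo_defect by (intro defect_zero_diff L2_continuous L2_indicator continuous_intros)
    moreover have "indicator (UNIV - A) = (\<lambda>x. expo 0 x - indicator A x)"
      by (auto simp: fun_eq_iff indicator_def expo_def)
    ultimately show ?case by simp
  next
    case (union A)
    have A: "A i \<in> sets borel" for i
      using union(2) by (auto simp: borel_eq_closed)
    have eq: "indicator (\<Union>i<n. A i) = (\<lambda>x. \<Sum>i<n. indicator (A i) x :: complex)" for n
      using union(1) by (auto simp: fun_eq_iff intro!: indicator_UN_disjoint intro: disjoint_family_on_mono)
    show ?case
    proof (rule defect_zero_dominated[where w = "\<lambda>_. 1" and g = "\<lambda>n. indicator (\<Union>i<n. A i)"])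
      show "indicator (\<Union> (range A)) \<in> borel_measurable M"
        using A by (auto simp: measurable_M)
      show "indicator (\<Union>i<n. A i) \<in> L2 M" for n
        using A by (intro L2_indicator) auto
      show "defect (indicator (\<Union>i<n. A i)) = 0" for n
        unfolding eq using A union(3) by (intro defect_zero_sum) (auto simp: L2_indicator)
      show "(\<lambda>n. indicator (\<Union>i<n. A i) x) \<longlonglongrightarrow> (indicator (\<Union> (range A)) x :: complex)" for x
        by (rule LIMSEQ_indicator_UN)
    qed (auto simp: indicator_def)
  qed
qed

lemma defect_zero_L2:
  assumes f: "f \<in> L2 M"
  shows "defect f = 0"
proof -
  obtain g where g: "\<And>i. simple_function M (g i)" "\<And>x. (\<lambda>i. g i x) \<longlonglongrightarrow> f x"
    "\<And>i x. dist (g i x) 0 \<le> 2 * dist (f x) 0"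
    using borel_measurable_implies_sequence_metric[OF L2_measurable[OF f], of 0]
    by (auto simp: space_M)
  have level: "g i -` {y} \<in> sets borel" for i y
    using simple_functionD(2)[OF g(1), of i "{y}"] by (simp add: space_M sets_M)
  have fin: "finite (range (g i))" for i
    using simple_functionD(1)[OF g(1), of i] by (simp add: space_M)
  have eq: "g i = (\<lambda>x. \<Sum>y\<in>range (g i). y * indicator (g i -` {y}) x)" for i
    by (auto simp: fun_eq_iff indicator_def fin if_distrib sum.delta' cong: if_cong)
  have piece: "(\<lambda>x. y * indicator (g i -` {y}) x) \<in> L2 M"
    "defect (\<lambda>x. y * indicator (g i -` {y}) x) = 0" for i y
    using level by (auto intro: L2_scale L2_indicator defect_zero_scale defect_zero_indicator)
  show ?thesis
  proof (rule defect_zero_dominated[where w = "\<lambda>x. 2 * norm (f x)" and g = g])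
    show "g n \<in> L2 M" for n
      by (subst eq) (intro L2_sum fin piece)
    show "defect (g n) = 0" for n
      by (subst eq) (intro defect_zero_sum fin conjI piece)
    show "integrable M (\<lambda>x. (2 * norm (f x))\<^sup>2)"
      using f by (simp add: L2_def power_mult_distrib)
    show "norm (g n x) \<le> 2 * norm (f x)" for n x
      using g(3)[of n x] by simp
  qed (use L2_measurable[OF f] g in auto)
qed

end

section \<open>Words and invariant measures\<close>

text \<open>Expanding the squared modulus and moving the sum over \<open>l\<close> innermost leaves
  inner products of columns. The matrix may have more rows than columns, so this is an isometry and
  need not be unitary.\<close>

lemma orthonormal_columns_isometry:
  fixes a :: "'l \<Rightarrow> 'b \<Rightarrow> complex"
  assumes "finite L" "finite B"
    and orth: "\<And>b b'. b \<in> B \<Longrightarrow> b' \<in> B \<Longrightarrow> (\<Sum>l\<in>L. a l b * cnj (a l b')) = (if b = b' then 1 else 0)"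
  shows "(\<Sum>l\<in>L. (norm (\<Sum>b\<in>B. cnj (a l b) * v b))\<^sup>2) = (\<Sum>b\<in>B. (norm (v b))\<^sup>2)"
proof -
  have "complex_of_real (\<Sum>l\<in>L. (norm (\<Sum>b\<in>B. cnj (a l b) * v b))\<^sup>2)
      = (\<Sum>l\<in>L. (\<Sum>b\<in>B. cnj (a l b) * v b) * cnj (\<Sum>b\<in>B. cnj (a l b) * v b))"
    by (simp only: of_real_sum complex_norm_square)
  also have "\<dots> = (\<Sum>l\<in>L. \<Sum>b\<in>B. \<Sum>b'\<in>B. (v b * cnj (v b')) * (a l b' * cnj (a l b)))"
    by (simp add: sum_product algebra_simps)
  also have "\<dots> = (\<Sum>b\<in>B. \<Sum>l\<in>L. \<Sum>b'\<in>B. (v b * cnj (v b')) * (a l b' * cnj (a l b)))"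
    by (rule sum.swap)
  also have "\<dots> = (\<Sum>b\<in>B. \<Sum>b'\<in>B. \<Sum>l\<in>L. (v b * cnj (v b')) * (a l b' * cnj (a l b)))"
    by (intro sum.cong refl sum.swap)
  also have "\<dots> = (\<Sum>b\<in>B. \<Sum>b'\<in>B. if b' = b then v b * cnj (v b) else 0)"
    by (intro sum.cong refl) (simp add: sum_distrib_left[symmetric] orth)
  also have "\<dots> = (\<Sum>b\<in>B. v b * cnj (v b))"
    using assms by (intro sum.cong refl) simp
  also have "\<dots> = complex_of_real (\<Sum>b\<in>B. (norm (v b))\<^sup>2)"
    by (simp only: of_real_sum complex_norm_square)
  finally show ?thesis by (simp only: of_real_eq_iff)
qed

lemma expo_of_int_add:
  "expo t (x + of_int b) = expo t x * cis (2 * pi * (t * of_int b))"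
  by (simp add: expo_def cis_mult algebra_simps)

lemma cis_two_pi_int: "cis (2 * pi * of_int k) = 1"
  by (rule complex_eqI) (simp_all add: cos_int_2pin sin_int_2pin)

lemma word_freq_Nil [simp]: "word_freq R [] = 0"
  by (simp add: word_freq_def)

lemma word_weight_Nil [simp]: "word_weight \<alpha> [] = 1"
  by (simp add: word_weight_def)

lemma word_freq_Cons: "word_freq R (l # ws) = l + R * word_freq R ws"
  by (simp add: word_freq_def sum.lessThan_Suc_shift sum_distrib_left mult.assoc del: sum.lessThan_Suc)

lemma word_weight_Cons: "word_weight \<alpha> (l # ws) = \<alpha> l * word_weight \<alpha> ws"
  by (simp add: word_weight_def prod.lessThan_Suc_shift del: prod.lessThan_Suc)

text \<open>A finite exhaustion of \<open>Omega L\<close>, indexed by length so that removing the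
  first letter becomes an induction on \<open>n\<close>.\<close>

definition Omega_upto :: "int set \<Rightarrow> nat \<Rightarrow> int list set" where
  "Omega_upto L n = {ws \<in> Omega L. length ws \<le> n}"

lemma Omega_upto_subset: "Omega_upto L n \<subseteq> Omega L"
  by (simp add: Omega_upto_def)

lemma Omega_upto_0: "Omega_upto L 0 = {[]}"
  by (auto simp: Omega_upto_def Omega_def)

lemma finite_Omega_upto:
  assumes "finite L"
  shows "finite (Omega_upto L n)"
proof (rule finite_subset)
  show "Omega_upto L n \<subseteq> {ws. set ws \<subseteq> L \<and> length ws \<le> n}"
    by (auto simp: Omega_upto_def Omega_def)
  show "finite {ws. set ws \<subseteq> L \<and> length ws \<le> n}"
    using assms by (rule finite_lists_length_le)
qed

lemma finite_subset_Omega_upto: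
  assumes "finite S" "S \<subseteq> Omega L"
  obtains n where "S \<subseteq> Omega_upto L n"
proof
  show "S \<subseteq> Omega_upto L (Max (length ` S))"
    using assms by (auto simp: Omega_upto_def)
qed

lemma Omega_upto_mono: "m \<le> n \<Longrightarrow> Omega_upto L m \<subseteq> Omega_upto L n"
  by (auto simp: Omega_upto_def)

text \<open>
  Since words do not end in \<open>0\<close>, prepending the digit \<open>0\<close> to the empty word has to give the
  empty word again; the hypothesis makes this identification harmless.
\<close>

lemma sum_Omega_upto_Suc:
  fixes G :: "int list \<Rightarrow> 'a::comm_monoid_add"
  assumes L: "finite L" "0 \<in> L" and G: "G [0] = G []"
  shows "sum G (Omega_upto L (Suc n)) = (\<Sum>l\<in>L. \<Sum>ws\<in>Omega_upto L n. G (l # ws))"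
proof -
  define cons where "cons = (\<lambda>(l::int, ws). if l = 0 \<and> ws = [] then [] else l # ws)"
  have inj: "inj_on cons (L \<times> Omega_upto L n)"
    by (auto simp: inj_on_def cons_def split: if_splits)
  have image: "cons ` (L \<times> Omega_upto L n) = Omega_upto L (Suc n)"
  proof
    show "cons ` (L \<times> Omega_upto L n) \<subseteq> Omega_upto L (Suc n)"
      by (auto simp: cons_def Omega_upto_def Omega_def split: if_splits)
    show "Omega_upto L (Suc n) \<subseteq> cons ` (L \<times> Omega_upto L n)"
    proof
      fix ws assume ws: "ws \<in> Omega_upto L (Suc n)"
      show "ws \<in> cons ` (L \<times> Omega_upto L n)"
      proof (cases ws)
        case Nil
        then have "ws = cons (0, [])" by (simp add: cons_def)
        moreover have "[] \<in> Omega_upto L n" by (simp add: Omega_upto_def Omega_def)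
        ultimately show ?thesis using L by blast
      next
        case (Cons l vs)
        then have "ws = cons (l, vs)" "l \<in> L" "vs \<in> Omega_upto L n"
          using ws by (auto simp: cons_def Omega_upto_def Omega_def split: if_splits)
        then show ?thesis by blast
      qed
    qed
  qed
  have "sum G (Omega_upto L (Suc n)) = (\<Sum>p\<in>L \<times> Omega_upto L n. G (cons p))"
    unfolding image[symmetric] by (simp add: sum.reindex[OF inj])
  also have "\<dots> = (\<Sum>(l, ws)\<in>L \<times> Omega_upto L n. G (l # ws))"
    by (intro sum.cong) (auto simp: cons_def G)
  also have "\<dots> = (\<Sum>l\<in>L. \<Sum>ws\<in>Omega_upto L n. G (l # ws))"
    by (simp add: sum.cartesian_product)
  finally show ?thesis .
qed

section \<open>Invariance of the measure as a change of variables\<close>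

locale ifs_measure =
  fixes R :: int and B :: "int set" and M :: "real measure"
  assumes R: "\<bar>R\<bar> \<ge> 2" and finite_B: "finite B" and zero_B: "0 \<in> B"
    and mu: "is_ifs_measure R B M"

sublocale ifs_measure \<subseteq> prob_space M
  using mu by (simp add: is_ifs_measure_def)

context ifs_measure
begin

lemma sets_M [measurable_cong]: "sets M = sets borel"
  using mu by (simp add: is_ifs_measure_def)

lemma space_M [simp]: "space M = UNIV"
  using sets_eq_imp_space_eq[OF sets_M] by simp

lemma measurable_M: "borel_measurable M = borel_measurable borel"
  by (rule measurable_cong_sets[OF sets_M refl])

lemma R_nz: "real_of_int R \<noteq> 0"
  using R by auto

lemma card_B: "real (card B) > 0"
  using finite_B zero_B by (simp add: card_gt_0_iff) blast

lemma measurable_tau [measurable]: "tau R b \<in> borel_measurable borel"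
  unfolding tau_def by measurable

lemma measure_ifs:
  "E \<in> sets borel \<Longrightarrow> measure M E = (\<Sum>b\<in>B. measure M (tau R b -` E)) / real (card B)"
  using mu by (simp add: is_ifs_measure_def)

text \<open>Invariance in probabilistic form: \<open>M\<close> is the law of
  \<open>tau R b x\<close> for \<open>b\<close> uniform on \<open>B\<close> and \<open>x\<close>
  independent with law \<open>M\<close>. Integrals can then be handled by Fubini on the
  product.\<close>

lemma M_eq_distr:
  "M = distr (measure_pmf (pmf_of_set B) \<Otimes>\<^sub>M M) borel (\<lambda>(b, x). tau R b x)" (is "M = distr ?P borel ?f")
proof (rule measure_eqI)
  show "sets M = sets (distr ?P borel ?f)" by (simp add: sets_M)
  have "(\<lambda>(b, x). tau R b x) \<in> measurable (count_space UNIV \<Otimes>\<^sub>M M) borel"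
    by (rule measurable_pair_measure_countable1) (auto simp: measurable_M)
  then have f[measurable]: "?f \<in> measurable ?P borel"
    by (simp cong: measurable_cong_sets)
  fix E assume "E \<in> sets M"
  then have E: "E \<in> sets borel" by (simp add: sets_M)
  have "emeasure (distr ?P borel ?f) E = emeasure ?P (?f -` E \<inter> space ?P)"
    using E by (intro emeasure_distr f)
  also have "\<dots> = (\<integral>\<^sup>+b. emeasure M (Pair b -` (?f -` E \<inter> space ?P)) \<partial>measure_pmf (pmf_of_set B))"
    using E by (intro emeasure_pair_measure_alt measurable_sets[OF f])
  also have "\<dots> = (\<integral>\<^sup>+b. emeasure M (tau R b -` E) \<partial>measure_pmf (pmf_of_set B))"
    by (intro nn_integral_cong arg_cong[where f = "emeasure M"]) (auto simp: space_pair_measure)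
  also have "\<dots> = (\<Sum>b\<in>B. emeasure M (tau R b -` E)) / card B"
    using finite_B zero_B by (intro nn_integral_pmf_of_set) auto
  also have "\<dots> = ennreal ((\<Sum>b\<in>B. measure M (tau R b -` E)) / real (card B))"
    using card_B by (simp add: emeasure_eq_measure sum_nonneg divide_ennreal[symmetric]
        ennreal_of_nat_eq_real_of_nat)
  also have "\<dots> = emeasure M E"
    using measure_ifs[OF E] by (simp add: emeasure_eq_measure)
  finally show "emeasure M E = emeasure (distr ?P borel ?f) E" by simp
qed

lemma
  fixes \<phi> :: "real \<Rightarrow> 'b::{banach, second_countable_topology}"
  assumes \<phi>: "integrable M \<phi>"
  shows integrable_tau: "b \<in> B \<Longrightarrow> integrable M (\<lambda>x. \<phi> (tau R b x))"
    and integral_ifs: "(LINT x|M. \<phi> x) = (\<Sum>b\<in>B. LINT x|M. \<phi> (tau R b x)) /\<^sub>R real (card B)"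
proof -
  let ?P = "measure_pmf (pmf_of_set B) \<Otimes>\<^sub>M M" and ?f = "\<lambda>(b, x). tau R b x"
  interpret pair_sigma_finite "measure_pmf (pmf_of_set B)" M ..
  have "(\<lambda>(b, x). tau R b x) \<in> measurable (count_space UNIV \<Otimes>\<^sub>M M) borel"
    by (rule measurable_pair_measure_countable1) (auto simp: measurable_M)
  then have f: "?f \<in> measurable ?P borel"
    by (simp cong: measurable_cong_sets)
  have meas: "\<phi> \<in> borel_measurable borel"
    using \<phi> measurable_M by auto
  have "integrable (distr ?P borel ?f) \<phi>"
    using \<phi> M_eq_distr by simp
  then have int: "integrable ?P (\<lambda>(b, x). \<phi> (tau R b x))"
    using integrable_distr_eq[OF f meas] by (simp add: case_prod_unfold)
  have set: "set_pmf (pmf_of_set B) = B"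
    using finite_B zero_B by (intro set_pmf_of_set) auto
  show "integrable M (\<lambda>x. \<phi> (tau R b x))" if "b \<in> B"
    \<comment> \<open>Every \<open>b\<close> in \<open>B\<close> has positive mass, so almost every
      \<open>b\<close> means each \<open>b\<close> in \<open>B\<close>.\<close>
    using AE_integrable_fst[OF int] that by (simp add: AE_measure_pmf_iff set)
  have "(LINT x|M. \<phi> x) = (LINT x|distr ?P borel ?f. \<phi> x)"
    using M_eq_distr by simp
  also have "\<dots> = (LINT p|?P. (\<lambda>(b, x). \<phi> (tau R b x)) p)"
    using integral_distr[OF f meas] by (simp add: case_prod_unfold)
  also have "\<dots> = (LINT b|measure_pmf (pmf_of_set B). LINT x|M. \<phi> (tau R b x))"
    by (rule integral_fst[OF int, symmetric])
  also have "\<dots> = (\<Sum>b\<in>B. pmf (pmf_of_set B) b *\<^sub>R (LINT x|M. \<phi> (tau R b x)))"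
    using finite_B set by (intro integral_measure_pmf) auto
  also have "\<dots> = (\<Sum>b\<in>B. LINT x|M. \<phi> (tau R b x)) /\<^sub>R real (card B)"
    using finite_B zero_B by (subst scaleR_sum_right, intro sum.cong refl)
      (subst pmf_of_set, auto simp: inverse_eq_divide)
  finally show "(LINT x|M. \<phi> x) = (\<Sum>b\<in>B. LINT x|M. \<phi> (tau R b x)) /\<^sub>R real (card B)" .
qed

section \<open>Boundedness of the support\<close>

definition radius :: real where
  "radius = 1 + (\<Sum>b\<in>B. \<bar>real_of_int b\<bar>)"

text \<open>The choice of \<open>radius\<close> gives
  \<open>r + 1 + \<bar>b\<bar> \<le> 2 * r \<le> \<bar>R\<bar> * r\<close>, so every branch maps the
  interval of radius \<open>r + 1\<close> into that of radius \<open>r\<close>.\<close>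

lemma measure_interval_mono:
  assumes r: "r \<ge> radius"
  shows "measure M {-(r + 1)..r + 1} \<le> measure M {-r..r}"
proof -
  have sub: "{-(r + 1)..r + 1} \<subseteq> tau R b -` {-r..r}" if b: "b \<in> B" for b
  proof
    fix x assume "x \<in> {-(r + 1)..r + 1}"
    then have "\<bar>x\<bar> \<le> r + 1" by auto
    moreover have "\<bar>real_of_int b\<bar> \<le> (\<Sum>b\<in>B. \<bar>real_of_int b\<bar>)"
      using finite_B b by (intro member_le_sum) auto
    ultimately have "\<bar>x + of_int b\<bar> \<le> 2 * r"
      using r unfolding radius_def by linarith
    also have "\<dots> \<le> \<bar>real_of_int R\<bar> * r"
    proof (rule mult_right_mono)
      show "2 \<le> \<bar>real_of_int R\<bar>" using R by linarith
      have "0 \<le> (\<Sum>b\<in>B. \<bar>real_of_int b\<bar>)" by (intro sum_nonneg) simp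
      then show "0 \<le> r" using r unfolding radius_def by linarith
    qed
    finally have "\<bar>tau R b x\<bar> \<le> r"
      using R_nz by (simp add: tau_def field_simps)
    then show "x \<in> tau R b -` {-r..r}" by (simp add: abs_le_iff minus_le_iff)
  qed
  have "measure M {-(r + 1)..r + 1} = (\<Sum>b\<in>B. measure M {-(r + 1)..r + 1}) / real (card B)"
    using card_B by simp
  also have "\<dots> \<le> (\<Sum>b\<in>B. measure M (tau R b -` {-r..r})) / real (card B)"
  proof (intro divide_right_mono sum_mono finite_measure_mono sub)
    fix b
    show "tau R b -` {-r..r} \<in> sets M"
      using measurable_sets[OF measurable_tau, of "{-r..r}" b] by (simp add: sets_M)
  qed auto
  also have "\<dots> = measure M {-r..r}"
    by (rule measure_ifs[symmetric]) simp
  finally show ?thesis .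
qed

text \<open>Enlarging the interval by 1 any number of times adds no mass, yet the enlarged intervals
  exhaust the line; so \<open>{-radius..radius}\<close> already has mass 1.\<close>

lemma AE_bounded: "AE x in M. \<bar>x\<bar> \<le> radius"
proof -
  let ?A = "\<lambda>n. {-(radius + real n)..radius + real n}"
  have le: "measure M (?A n) \<le> measure M {-radius..radius}" for n
  proof (induction n)
    case (Suc n)
    have "measure M (?A (Suc n)) \<le> measure M (?A n)"
      using measure_interval_mono[of "radius + real n"] by (simp add: algebra_simps)
    with Suc show ?case by simp
  qed simp
  have "(\<lambda>n. measure M (?A n)) \<longlonglongrightarrow> measure M (\<Union>n. ?A n)"
    by (rule finite_Lim_measure_incseq) (auto simp: sets_M incseq_def)
  also have "(\<Union>n. ?A n) = space M"
  proof -
    have "x \<in> (\<Union>n. ?A n)" for x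
    proof -
      obtain n where "\<bar>x\<bar> + \<bar>radius\<bar> < real n" using reals_Archimedean2 by blast
      then have "x \<in> ?A n" by (auto simp: abs_if split: if_splits)
      then show ?thesis by blast
    qed
    then show ?thesis by auto
  qed
  finally have "1 \<le> measure M {-radius..radius}"
    using le by (intro LIMSEQ_le_const2[where X = "\<lambda>n. measure M (?A n)"]) (use prob_space in auto)
  then have "measure M {-radius..radius} = 1"
    using prob_le_1 by (intro antisym)
  then have "AE x in M. x \<in> {-radius..radius}"
    by (rule AE_prob_1)
  then show ?thesis by eventually_elim auto
qed

lemma expo_L2: "expo t \<in> L2 M"
  by (rule L2_bounded[where K = 1])
     (auto simp: measurable_M intro!: borel_measurable_continuous_onI continuous_on_expo)

lemma L2_integrable:
  assumes "f \<in> L2 M"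
  shows "integrable M f"
  using L2_mult_integrable[OF assms expo_L2[of 0]] by (simp add: expo_def)

lemma norm_integral_square_le:
  assumes f: "f \<in> L2 M"
  shows "(norm (LINT x|M. f x))\<^sup>2 \<le> L2_norm_sq M f"
proof -
  have i: "integrable M (\<lambda>x. norm (f x))" "integrable M (\<lambda>x. (norm (f x))\<^sup>2)"
    using f L2_integrable[OF f] by (auto simp: L2_def)
  have "(norm (LINT x|M. f x))\<^sup>2 \<le> (LINT x|M. norm (f x))\<^sup>2"
    by (intro power_mono integral_norm_bound) auto
  also have "\<dots> \<le> (LINT x|M. (norm (f x))\<^sup>2)"
    using variance_eq[OF i] variance_positive[of "\<lambda>x. norm (f x)"] by simp
  finally show ?thesis by (simp add: L2_norm_sq_def)
qed

section \<open>Transfer operators and their action on exponentials\<close>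

lemma L2_tau:
  assumes f: "f \<in> L2 M" and b: "b \<in> B"
  shows "(\<lambda>x. f (tau R b x)) \<in> L2 M"
proof -
  have "f \<in> borel_measurable borel" using L2_measurable[OF f] by (simp add: measurable_M)
  then have "(\<lambda>x. f (tau R b x)) \<in> borel_measurable borel" by measurable
  moreover have "integrable M (\<lambda>x. (norm (f (tau R b x)))\<^sup>2)"
    using integrable_tau[OF _ b, of "\<lambda>x. (norm (f x))\<^sup>2"] f by (simp add: L2_def)
  ultimately show ?thesis by (simp add: L2_def measurable_M)
qed

text \<open>The operator \<open>T\<^sub>l\<close> of the introduction, a transfer operator of Ruelle
  type with weight \<open>cnj (expo l)\<close>.\<close>

definition transfer :: "int \<Rightarrow> (real \<Rightarrow> complex) \<Rightarrow> real \<Rightarrow> complex" where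
  "transfer l f x = (\<Sum>b\<in>B. cnj (expo (of_int l) (tau R b x)) * f (tau R b x)) / of_nat (card B)"

lemma transfer_summand_L2:
  assumes f: "f \<in> L2 M" and b: "b \<in> B"
  shows "(\<lambda>x. cnj (expo (of_int l) (tau R b x)) * f (tau R b x)) \<in> L2 M"
proof -
  have "continuous_on UNIV (\<lambda>x. cnj (expo (of_int l) (tau R b x)))"
    unfolding expo_def tau_def by (intro continuous_intros) (use R_nz in auto)
  then have "(\<lambda>x. cnj (expo (of_int l) (tau R b x))) \<in> borel_measurable M"
    unfolding measurable_M by (rule borel_measurable_continuous_onI)
  then show ?thesis
    using L2_tau[OF f b] by (auto simp: L2_def norm_mult)
qed

lemma transfer_L2:
  assumes "f \<in> L2 M"
  shows "transfer l f \<in> L2 M"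
proof -
  have "(\<lambda>x. (1 / of_nat (card B)) * (\<Sum>b\<in>B. cnj (expo (of_int l) (tau R b x)) * f (tau R b x))) \<in> L2 M"
    using finite_B assms by (intro L2_scale L2_sum transfer_summand_L2)
  moreover have "transfer l f = (\<lambda>x. (1 / of_nat (card B)) * (\<Sum>b\<in>B. cnj (expo (of_int l) (tau R b x)) * f (tau R b x)))"
    by (simp add: transfer_def fun_eq_iff)
  ultimately show ?thesis by simp
qed

text \<open>The factor of frequency \<open>R * k\<close> loses the dependence on \<open>b\<close>,
  because \<open>k * b\<close> is an integer. This is what lets the first letter of a word be split
  off.\<close>

lemma expo_tau_split:
  "expo (of_int (l + R * k)) (tau R b x) = expo (of_int l) (tau R b x) * expo (of_int k) x"
proof -
  have "of_int (R * k) * tau R b x = of_int k * x + of_int (k * b)"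
    using R_nz by (simp add: tau_def field_simps)
  then have "expo (of_int (R * k)) (tau R b x) = expo (of_int k) x * cis (2 * pi * of_int (k * b))"
    by (simp only: expo_def cis_mult mult.assoc distrib_left)
  then show ?thesis
    by (simp only: cis_two_pi_int of_int_add expo_add[symmetric] mult_1_right)
qed

lemma inner_transfer:
  assumes f: "f \<in> L2 M"
  shows "L2_inner M f (\<lambda>x. c * expo (of_int (l + R * k)) x)
           = L2_inner M (transfer l f) (\<lambda>x. c * expo (of_int k) x)"
proof -
  let ?g = "\<lambda>x. c * expo (of_int (l + R * k)) x" and ?h = "\<lambda>x. c * expo (of_int k) x"
  let ?s = "\<lambda>b x. cnj (expo (of_int l) (tau R b x)) * f (tau R b x)"
  have g: "?g \<in> L2 M" and h: "?h \<in> L2 M" by (intro L2_scale expo_L2)+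
  have "L2_inner M f ?g = (\<Sum>b\<in>B. LINT x|M. f (tau R b x) * cnj (?g (tau R b x))) /\<^sub>R real (card B)"
    unfolding L2_inner_def by (rule integral_ifs[OF L2_mult_integrable[OF f g]])
  also have "(\<Sum>b\<in>B. LINT x|M. f (tau R b x) * cnj (?g (tau R b x)))
      = (\<Sum>b\<in>B. LINT x|M. ?s b x * cnj (?h x))"
    by (simp only: expo_tau_split complex_cnj_mult mult_ac)
  also have "\<dots> = (LINT x|M. (\<Sum>b\<in>B. ?s b x * cnj (?h x)))"
    by (rule Bochner_Integration.integral_sum[symmetric])
       (intro L2_mult_integrable transfer_summand_L2 f h)
  also have "\<dots> /\<^sub>R real (card B) = (LINT x|M. (\<Sum>b\<in>B. ?s b x * cnj (?h x)) /\<^sub>R real (card B))"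
    by simp
  also have "\<dots> = L2_inner M (transfer l f) ?h"
    unfolding L2_inner_def transfer_def
    by (simp only: sum_distrib_right[symmetric])
       (simp add: scaleR_conv_of_real divide_inverse mult_ac)
  finally show ?thesis .
qed

definition mask :: "real \<Rightarrow> complex" where
  "mask y = (\<Sum>b\<in>B. cis (2 * pi * (y * of_int b))) / of_nat (card B)"

lemma transfer_expo:
  "transfer l (expo t) = (\<lambda>x. mask ((t - of_int l) / of_int R) * expo ((t - of_int l) / of_int R) x)"
proof
  fix x
  let ?y = "(t - of_int l) / of_int R"
  have "cnj (expo (of_int l) (tau R b x)) * expo t (tau R b x) = cis (2 * pi * (?y * of_int b)) * expo ?y x" for b
  proof -
    have "cnj (expo (of_int l) (tau R b x)) * expo t (tau R b x) = expo (t - of_int l) (tau R b x)"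
      by (simp add: expo_def cis_cnj cis_mult algebra_simps)
    also have "\<dots> = expo ?y (x + of_int b)"
      by (simp add: expo_def tau_def)
    finally show ?thesis by (simp add: expo_of_int_add mult.commute)
  qed
  then show "transfer l (expo t) x = mask ?y * expo ?y x"
    by (simp add: transfer_def mask_def sum_distrib_right)
qed

text \<open>Within a class the arguments differ by \<open>(l' - l) / R\<close>, whose product with
  each \<open>b\<close> is an integer, so every summand is unchanged. Admissibility of a digit thus
  depends only on its class.\<close>

lemma mask_cls:
  assumes "l' \<in> cls R B l"
  shows "mask ((x - of_int l') / of_int R) = mask ((x - of_int l) / of_int R)"
proof -
  have "cis (2 * pi * ((x - of_int l') / of_int R * of_int b)) = cis (2 * pi * ((x - of_int l) / of_int R * of_int b))"
    if b: "b \<in> B" for b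
  proof -
    obtain k where k: "of_int ((l' - l) * b) / real_of_int R = of_int k"
      using assms b unfolding cls_def Ints_def by auto
    have "(x - of_int l) / of_int R * of_int b
        = (x - of_int l') / of_int R * of_int b + of_int ((l' - l) * b) / real_of_int R"
      using R_nz by (simp add: field_simps)
    then have "cis (2 * pi * ((x - of_int l) / of_int R * of_int b))
        = cis (2 * pi * ((x - of_int l') / of_int R * of_int b)) * cis (2 * pi * of_int k)"
      by (simp only: k distrib_left cis_mult)
    then show ?thesis by (simp only: cis_two_pi_int mult_1_right)
  qed
  then show ?thesis unfolding mask_def by (simp cong: sum.cong)
qed

end

section \<open>The frame of weighted exponentials\<close>

text \<open>Montel's theorem in the form used for the energies: a bound depending monotonically on
  \<open>norm z\<close> is uniform on compact sets.\<close>

lemma holomorphic_limit_of_bounded: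
  fixes G :: "nat \<Rightarrow> complex \<Rightarrow> complex"
  assumes hol: "\<And>n. G n holomorphic_on UNIV"
    and bound: "\<And>n z. norm (G n z) \<le> b (norm z)" and mono: "mono b"
  obtains g r where "g holomorphic_on UNIV" "strict_mono (r :: nat \<Rightarrow> nat)"
    "\<And>z. (\<lambda>n. G (r n) z) \<longlonglongrightarrow> g z"
proof (rule Montel[of UNIV "range G" G])
  fix K :: "complex set" assume K: "compact K"
  obtain D where D: "\<And>z. z \<in> K \<Longrightarrow> norm z \<le> D"
    using compact_imp_bounded[OF K] unfolding bounded_iff by metis
  have "norm (G n z) \<le> b D" if "z \<in> K" for n z
    using bound[of n z] monoD[OF mono D[OF that]] by linarith
  then show "\<exists>B. \<forall>h\<in>range G. \<forall>z\<in>K. norm (h z) \<le> B" by auto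
qed (use hol that in auto)

locale ifs_frame = ifs_measure R B M
  for R :: int and B :: "int set" and M :: "real measure" +
  fixes L :: "int set" and \<alpha> :: "int \<Rightarrow> complex"
  assumes finite_L: "finite L" and zero_L: "0 \<in> L"
    and alpha_0: "\<alpha> 0 = 1"
    and orth: "\<forall>b\<in>B. \<forall>b'\<in>B.
       (\<Sum>l\<in>L. (cis (2 * pi * of_int (l * b) / of_int R) * \<alpha> l / sqrt (real (card B)))
              * cnj (cis (2 * pi * of_int (l * b') / of_int R) * \<alpha> l / sqrt (real (card B))))
       = (if b = b' then 1 else 0)"
begin

definition frame :: "int list \<Rightarrow> real \<Rightarrow> complex" where
  "frame ws x = word_weight \<alpha> ws * expo (of_int (word_freq R ws)) x"

lemma frame_L2: "frame ws \<in> L2 M"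
  unfolding frame_def[abs_def] by (intro L2_scale expo_L2)

text \<open>At fixed \<open>x\<close> the values of \<open>f\<close> on the branches form a vector
  indexed by \<open>B\<close>. Up to a unimodular factor independent of \<open>b\<close>, the
  operators apply the conjugated matrix to it, so the isometry lemma applies.\<close>

lemma sum_transfer_norm_pointwise:
  "(\<Sum>l\<in>L. (norm (\<alpha> l))\<^sup>2 * (norm (transfer l f x))\<^sup>2)
     = (\<Sum>b\<in>B. (norm (f (tau R b x)))\<^sup>2) / real (card B)"
proof -
  define a where "a l b = cis (2 * pi * of_int (l * b) / of_int R) * \<alpha> l / sqrt (real (card B))" for l b :: int
  have N: "real (card B) > 0" by (rule card_B)
  have "(norm (\<alpha> l))\<^sup>2 * (norm (transfer l f x))\<^sup>2
      = (norm (\<Sum>b\<in>B. cnj (a l b) * f (tau R b x)))\<^sup>2 / real (card B)" for l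
  proof -
    have split: "expo (of_int l) (tau R b x) = expo (of_int l / of_int R) x * cis (2 * pi * of_int (l * b) / of_int R)" for b
      by (simp add: expo_def tau_def cis_mult add_divide_distrib algebra_simps)
    let ?S = "\<Sum>b\<in>B. cnj (cis (2 * pi * of_int (l * b) / of_int R)) * f (tau R b x)"
    have "transfer l f x = cnj (expo (of_int l / of_int R) x) * ?S / of_nat (card B)"
      unfolding transfer_def split by (simp add: sum_distrib_left mult.assoc)
    then have 1: "norm (transfer l f x) = norm ?S / real (card B)"
      by (simp add: norm_mult norm_divide)
    have "(\<Sum>b\<in>B. cnj (a l b) * f (tau R b x)) = cnj (\<alpha> l) / sqrt (real (card B)) * ?S"
      unfolding a_def by (simp add: sum_distrib_left mult_ac)
    then have 2: "norm (\<Sum>b\<in>B. cnj (a l b) * f (tau R b x)) = norm (\<alpha> l) / sqrt (real (card B)) * norm ?S"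
      by (simp only: norm_mult norm_divide complex_mod_cnj norm_of_real) (use N in simp)
    show ?thesis
      unfolding 1 2 using N by (simp add: power_mult_distrib power_divide power2_eq_square)
  qed
  then have "(\<Sum>l\<in>L. (norm (\<alpha> l))\<^sup>2 * (norm (transfer l f x))\<^sup>2)
      = (\<Sum>l\<in>L. (norm (\<Sum>b\<in>B. cnj (a l b) * f (tau R b x)))\<^sup>2) / real (card B)"
    by (simp add: sum_divide_distrib)
  also have "(\<Sum>l\<in>L. (norm (\<Sum>b\<in>B. cnj (a l b) * f (tau R b x)))\<^sup>2) = (\<Sum>b\<in>B. (norm (f (tau R b x)))\<^sup>2)"
    by (rule orthonormal_columns_isometry[OF finite_L finite_B]) (use orth in \<open>simp add: a_def\<close>)
  finally show ?thesis .
qed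

text \<open>After integration, invariance turns the average over the branches back into the squared
  norm of \<open>f\<close>.\<close>

lemma sum_transfer_norm:
  assumes f: "f \<in> L2 M"
  shows "(\<Sum>l\<in>L. (norm (\<alpha> l))\<^sup>2 * L2_norm_sq M (transfer l f)) = L2_norm_sq M f"
proof -
  have i: "integrable M (\<lambda>x. (norm (transfer l f x))\<^sup>2)" for l
    using transfer_L2[OF f] by (simp add: L2_def)
  have j: "integrable M (\<lambda>x. (norm (f x))\<^sup>2)" using f by (simp add: L2_def)
  have "(\<Sum>l\<in>L. (norm (\<alpha> l))\<^sup>2 * L2_norm_sq M (transfer l f))
      = (LINT x|M. (\<Sum>l\<in>L. (norm (\<alpha> l))\<^sup>2 * (norm (transfer l f x))\<^sup>2))"
    unfolding L2_norm_sq_def using i by (subst Bochner_Integration.integral_sum) auto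
  also have "\<dots> = (LINT x|M. (\<Sum>b\<in>B. (norm (f (tau R b x)))\<^sup>2) / real (card B))"
    by (simp only: sum_transfer_norm_pointwise)
  also have "\<dots> = (\<Sum>b\<in>B. LINT x|M. (norm (f (tau R b x)))\<^sup>2) / real (card B)"
    using integrable_tau[OF j] by (subst integral_divide_zero, subst Bochner_Integration.integral_sum) auto
  also have "\<dots> = L2_norm_sq M f"
    unfolding L2_norm_sq_def integral_ifs[OF j] by (simp add: divide_inverse)
  finally show ?thesis .
qed

section \<open>The Bessel inequality by induction on word length\<close>

definition energy_upto :: "nat \<Rightarrow> (real \<Rightarrow> complex) \<Rightarrow> real" where
  "energy_upto n f = (\<Sum>ws\<in>Omega_upto L n. (norm (L2_inner M f (frame ws)))\<^sup>2)"

lemma inner_frame_Cons: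
  assumes "f \<in> L2 M"
  shows "L2_inner M f (frame (l # ws)) = cnj (\<alpha> l) * L2_inner M (transfer l f) (frame ws)"
proof -
  have "L2_inner M f (frame (l # ws))
      = L2_inner M (transfer l f) (\<lambda>x. word_weight \<alpha> (l # ws) * expo (of_int (word_freq R ws)) x)"
    unfolding frame_def[abs_def] word_freq_Cons by (rule inner_transfer[OF assms])
  also have "\<dots> = (LINT x|M. cnj (\<alpha> l) * (transfer l f x * cnj (frame ws x)))"
    by (simp add: L2_inner_def frame_def word_weight_Cons mult_ac)
  finally show ?thesis
    by (simp add: L2_inner_def)
qed

lemma energy_upto_Suc:
  assumes "f \<in> L2 M"
  shows "energy_upto (Suc n) f = (\<Sum>l\<in>L. (norm (\<alpha> l))\<^sup>2 * energy_upto n (transfer l f))"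
proof -
  \<comment> \<open>The weight \<open>\<alpha> 0 = 1\<close> makes the word \<open>[0]\<close>
    interchangeable with the empty word, as the sum over first letters demands.\<close>
  have "frame [0] = frame []"
    by (simp add: frame_def fun_eq_iff word_weight_Cons word_freq_Cons alpha_0)
  then show ?thesis
    unfolding energy_upto_def using finite_L zero_L
    by (subst sum_Omega_upto_Suc)
       (simp_all add: inner_frame_Cons[OF assms] norm_mult power_mult_distrib sum_distrib_left)
qed

text \<open>For the empty word alone the bound says that the variance of the modulus is nonnegative.
  The induction step pairs the recursion for the energy with the norm identity of the same
  shape.\<close>

lemma energy_upto_le:
  assumes "f \<in> L2 M"
  shows "energy_upto n f \<le> L2_norm_sq M f"
  using assms
proof (induction n arbitrary: f)
  case 0
  then show ?case
    using norm_integral_square_le[OF 0]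
    by (simp add: energy_upto_def Omega_upto_0 frame_def L2_inner_def expo_def)
next
  case (Suc n)
  have "energy_upto (Suc n) f = (\<Sum>l\<in>L. (norm (\<alpha> l))\<^sup>2 * energy_upto n (transfer l f))"
    by (rule energy_upto_Suc[OF Suc.prems])
  also have "\<dots> \<le> (\<Sum>l\<in>L. (norm (\<alpha> l))\<^sup>2 * L2_norm_sq M (transfer l f))"
    using Suc.IH transfer_L2[OF Suc.prems] by (intro sum_mono mult_left_mono) auto
  also have "\<dots> = L2_norm_sq M f"
    by (rule sum_transfer_norm[OF Suc.prems])
  finally show ?case .
qed

end

sublocale ifs_frame \<subseteq> bessel_system M frame "Omega L"
proof
  show "frame i \<in> L2 M" for i by (rule frame_L2)
  fix f and S :: "int list set" assume f: "f \<in> L2 M" and S: "finite S" "S \<subseteq> Omega L"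
  obtain n where n: "S \<subseteq> Omega_upto L n" using finite_subset_Omega_upto[OF S] by blast
  have "(\<Sum>i\<in>S. (norm (L2_inner M f (frame i)))\<^sup>2) \<le> energy_upto n f"
    unfolding energy_upto_def using n finite_Omega_upto[OF finite_L] by (intro sum_mono2) auto
  also have "\<dots> \<le> L2_norm_sq M f" by (rule energy_upto_le[OF f])
  finally show "(\<Sum>i\<in>S. (norm (L2_inner M f (frame i)))\<^sup>2) \<le> L2_norm_sq M f" .
qed

context ifs_frame
begin

lemma energy_upto_tendsto:
  assumes "f \<in> L2 M"
  shows "(\<lambda>n. energy_upto n f) \<longlonglongrightarrow> energy f"
proof -
  have "filterlim (Omega_upto L) (finite_subsets_at_top (Omega L)) sequentially"
    unfolding filterlim_finite_subsets_at_top
  proof (intro allI impI)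
    fix S assume S: "finite S \<and> S \<subseteq> Omega L"
    then obtain m where m: "S \<subseteq> Omega_upto L m" using finite_subset_Omega_upto by blast
    show "\<forall>\<^sub>F n in sequentially. finite (Omega_upto L n) \<and> S \<subseteq> Omega_upto L n \<and> Omega_upto L n \<subseteq> Omega L"
      using eventually_ge_at_top[of m]
      by eventually_elim
         (use m Omega_upto_mono Omega_upto_subset finite_Omega_upto[OF finite_L] in blast)
  qed
  with energy_has_sum[OF assms] show ?thesis
    unfolding has_sum_def energy_upto_def by (rule filterlim_compose)
qed

text \<open>The recursion for truncated energies passes to the limit and is subtracted from the norm
  identity.\<close>

lemma defect_transfer:
  assumes f: "f \<in> L2 M"
  shows "defect f = (\<Sum>l\<in>L. (norm (\<alpha> l))\<^sup>2 * defect (transfer l f))"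
proof -
  have "(\<lambda>n. \<Sum>l\<in>L. (norm (\<alpha> l))\<^sup>2 * energy_upto n (transfer l f))
          \<longlonglongrightarrow> (\<Sum>l\<in>L. (norm (\<alpha> l))\<^sup>2 * energy (transfer l f))"
    by (intro tendsto_intros energy_upto_tendsto transfer_L2 f)
  moreover have "(\<lambda>n. energy_upto (Suc n) f) \<longlonglongrightarrow> energy f"
    using energy_upto_tendsto[OF f] by (rule LIMSEQ_Suc)
  ultimately have "energy f = (\<Sum>l\<in>L. (norm (\<alpha> l))\<^sup>2 * energy (transfer l f))"
    unfolding energy_upto_Suc[OF f] by (rule LIMSEQ_unique[rotated])
  then show ?thesis
    using sum_transfer_norm[OF f] by (simp add: defect_def right_diff_distrib sum_subtractf)
qed

section \<open>The random walk on frequencies\<close>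

definition prob_step :: "int \<Rightarrow> real \<Rightarrow> real" where
  "prob_step l t = (norm (\<alpha> l))\<^sup>2 * (norm (mask ((t - of_int l) / of_int R)))\<^sup>2"

lemma norm_sq_expo: "L2_norm_sq M (expo t) = 1"
  using prob_space by (simp add: L2_norm_sq_def)

text \<open>The norm identity for \<open>expo t\<close>, a function of norm 1, says that the
  transition weights add up to 1.\<close>

lemma sum_prob_step: "(\<Sum>l\<in>L. prob_step l t) = 1"
  using sum_transfer_norm[OF expo_L2, of t]
  by (simp add: transfer_expo L2_norm_sq_scale norm_sq_expo prob_step_def)

lemma defect_expo_step:
  "defect (expo t) = (\<Sum>l\<in>L. prob_step l t * defect (expo ((t - of_int l) / of_int R)))"
  by (subst defect_transfer[OF expo_L2])
     (simp add: transfer_expo defect_scale prob_step_def mult.assoc)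

text \<open>The empty word gives the frame vector \<open>expo 0\<close> itself, whose coefficient
  already exhausts the norm.\<close>

lemma defect_expo_0: "defect (expo 0) = 0"
proof -
  have "1 = (\<Sum>ws\<in>{[]}. (norm (L2_inner M (expo 0) (frame ws)))\<^sup>2)"
    using prob_space by (simp add: L2_inner_def frame_def expo_def)
  also have "\<dots> \<le> energy (expo 0)"
    unfolding energy_def
    by (intro finite_sum_le_infsum energy_summable expo_L2) (auto simp: Omega_def)
  finally show ?thesis
    using defect_nonneg[OF expo_L2[of 0]] by (simp add: defect_def norm_sq_expo)
qed

section \<open>Entire extension of the energy of exponentials\<close>

definition cexpo :: "complex \<Rightarrow> real \<Rightarrow> complex" where
  "cexpo z x = exp (2 * pi * \<i> * z * of_real x)"

lemma cexpo_of_real: "cexpo (of_real t) = expo t"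
  by (simp add: fun_eq_iff cexpo_def expo_def cis_conv_exp mult_ac)

lemma cexpo_mult_expo: "cexpo z x * cnj (expo t x) = cexpo (z - of_real t) x"
proof -
  have "cnj (expo t x) = exp (\<i> * of_real (- (2 * pi * t * x)))"
    unfolding expo_def cis_cnj by (rule cis_conv_exp)
  then show ?thesis
    by (simp add: cexpo_def exp_add[symmetric] algebra_simps)
qed

lemma AE_norm_cexpo_le: "AE x in M. norm (cexpo z x) \<le> exp (2 * pi * (radius * norm z))"
  using AE_bounded
proof eventually_elim
  case (elim x)
  have "norm (cexpo z x) \<le> exp (norm (2 * pi * \<i> * z * of_real x))"
    unfolding cexpo_def by (rule norm_exp)
  also have "norm (2 * pi * \<i> * z * of_real x) = 2 * pi * (\<bar>x\<bar> * norm z)"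
    by (simp add: norm_mult)
  also have "\<dots> \<le> 2 * pi * (radius * norm z)"
    using elim by (intro mult_left_mono mult_right_mono) auto
  finally show ?case by simp
qed

lemma cexpo_measurable: "cexpo z \<in> borel_measurable M"
proof -
  have "continuous_on UNIV (cexpo z)"
    unfolding cexpo_def[abs_def] by (intro continuous_intros)
  then show ?thesis unfolding measurable_M by (rule borel_measurable_continuous_onI)
qed

lemma cexpo_L2: "cexpo z \<in> L2 M"
  by (rule L2_bounded[OF cexpo_measurable AE_norm_cexpo_le])

lemma norm_sq_cexpo_le: "L2_norm_sq M (cexpo z) \<le> (exp (2 * pi * (radius * norm z)))\<^sup>2"
proof -
  have "L2_norm_sq M (cexpo z) \<le> (LINT x|M. (exp (2 * pi * (radius * norm z)))\<^sup>2)"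
    unfolding L2_norm_sq_def
  proof (rule integral_mono_AE)
    show "integrable M (\<lambda>x. (norm (cexpo z x))\<^sup>2)" using cexpo_L2 by (simp add: L2_def)
    show "AE x in M. (norm (cexpo z x))\<^sup>2 \<le> (exp (2 * pi * (radius * norm z)))\<^sup>2"
      using AE_norm_cexpo_le by eventually_elim (auto intro: power_mono)
  qed simp
  then show ?thesis using prob_space by simp
qed

definition fourier :: "complex \<Rightarrow> complex" where
  "fourier z = (LINT x|M. cexpo z x)"

lemma fourier_holomorphic: "fourier holomorphic_on S"
proof -
  \<comment> \<open>The Taylor coefficients are moments of \<open>M\<close>. Bounded support
    dominates the terms by \<open>K ^ n / fact n\<close>, which justifies termwise
    integration.\<close>
  define c where "c n = (LINT x|M. (2 * pi * \<i> * of_real x) ^ n /\<^sub>R fact n)" for n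
  have "(\<lambda>n. c n * (w - 0) ^ n) sums fourier w" for w
  proof -
    define u where "u n x = (2 * pi * \<i> * w * complex_of_real x) ^ n /\<^sub>R fact n" for n x
    define K where "K = 2 * pi * (radius * norm w)"
    have bound: "AE x in M. norm (u n x) \<le> K ^ n /\<^sub>R fact n" for n
      using AE_bounded
    proof eventually_elim
      case (elim x)
      have "norm (2 * pi * \<i> * w * complex_of_real x) = 2 * pi * (\<bar>x\<bar> * norm w)"
        by (simp add: norm_mult)
      also have "\<dots> \<le> K"
        unfolding K_def using elim by (intro mult_left_mono mult_right_mono) auto
      finally have "norm (2 * pi * \<i> * w * complex_of_real x) ^ n \<le> K ^ n"
        by (intro power_mono) auto
      then show ?case
        unfolding u_def by (simp add: norm_power divide_right_mono)
    qed
    have meas: "u n \<in> borel_measurable M" for n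
    proof -
      have "continuous_on UNIV (u n)"
        unfolding u_def[abs_def] by (intro continuous_intros)
      then show ?thesis unfolding measurable_M by (rule borel_measurable_continuous_onI)
    qed
    have int: "integrable M (u n)" for n
      by (rule integrable_const_bound[OF bound meas])
    have "summable (\<lambda>n. LINT x|M. norm (u n x))"
    proof (rule summable_comparison_test[OF _ summable_exp_generic[of K]])
      have "norm (LINT x|M. norm (u n x)) \<le> K ^ n /\<^sub>R fact n" for n
      proof -
        have "(LINT x|M. norm (u n x)) \<le> (LINT x|M. K ^ n /\<^sub>R fact n)"
          by (rule integral_mono_AE) (use int bound in auto)
        then show ?thesis using prob_space by simp
      qed
      then show "\<exists>N. \<forall>n\<ge>N. norm (LINT x|M. norm (u n x)) \<le> K ^ n /\<^sub>R fact n" by blast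
    qed
    moreover have "summable (\<lambda>n. norm (u n x))" for x
      unfolding u_def by (rule summable_norm_exp)
    ultimately have "(\<lambda>n. LINT x|M. u n x) sums (LINT x|M. (\<Sum>n. u n x))"
      using int by (intro sums_integral) auto
    also have "(\<lambda>n. LINT x|M. u n x) = (\<lambda>n. c n * (w - 0) ^ n)"
    proof
      fix n
      have "u n = (\<lambda>x. ((2 * pi * \<i> * of_real x) ^ n /\<^sub>R fact n) * w ^ n)"
        by (simp add: u_def fun_eq_iff power_mult_distrib mult_ac)
      then show "(LINT x|M. u n x) = c n * (w - 0) ^ n"
        by (simp add: c_def)
    qed
    also have "(LINT x|M. (\<Sum>n. u n x)) = fourier w"
      by (simp add: fourier_def cexpo_def u_def exp_def)
    finally show ?thesis .
  qed
  then have "fourier holomorphic_on ball 0 r" for r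
    by (intro power_series_holomorphic)
  then have "fourier field_differentiable at z" for z
    by (rule holomorphic_on_imp_differentiable_at[of _ "ball 0 (norm z + 1)"]) auto
  then show ?thesis
    by (simp add: holomorphic_on_def field_differentiable_at_within)
qed

lemma inner_cexpo_frame:
  "L2_inner M (cexpo z) (frame ws) = cnj (word_weight \<alpha> ws) * fourier (z - of_int (word_freq R ws))"
proof -
  have "cexpo z x * cnj (frame ws x) = cnj (word_weight \<alpha> ws) * cexpo (z - of_int (word_freq R ws)) x" for x
    using cexpo_mult_expo[of z x "of_int (word_freq R ws)"] by (simp add: frame_def)
  then show ?thesis by (simp add: L2_inner_def fourier_def)
qed

lemma cnj_fourier: "cnj (fourier (cnj z)) = fourier (- z)"
proof -
  have "cnj (cexpo (cnj z) x) = cexpo (- z) x" for x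
    by (simp add: cexpo_def exp_cnj)
  then show ?thesis
    using Bochner_Integration.integral_cnj[of M "cexpo (cnj z)"] by (simp add: fourier_def)
qed

text \<open>The truncated energies extend to entire functions that are locally bounded uniformly in
  \<open>n\<close>. Montel's theorem gives an entire limit along a subsequence, and on the real axis
  the limit is known.\<close>

lemma energy_entire:
  obtains g where "g holomorphic_on UNIV" "\<And>t. g (of_real t) = of_real (energy (expo t))"
proof -
  \<comment> \<open>Evaluating the conjugated factor at \<open>cnj z\<close> makes it holomorphic in
    \<open>z\<close>; for real \<open>z\<close> the product is the squared modulus.\<close>
  define G where "G n z = (\<Sum>ws\<in>Omega_upto L n.
      L2_inner M (cexpo z) (frame ws) * cnj (L2_inner M (cexpo (cnj z)) (frame ws)))" for n z
  have real: "G n (of_real t) = of_real (energy_upto n (expo t))" for n t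
    by (simp only: G_def energy_upto_def complex_cnj_complex_of_real cexpo_of_real of_real_sum
        complex_norm_square)
  have hol: "G n holomorphic_on UNIV" for n
  proof -
    have "cnj (fourier (cnj z - of_int k)) = fourier (of_int k - z)" for z k
      using cnj_fourier[of "z - of_int k"] by simp
    then have "G n = (\<lambda>z. \<Sum>ws\<in>Omega_upto L n. cnj (word_weight \<alpha> ws) * fourier (z - of_int (word_freq R ws))
        * (word_weight \<alpha> ws * fourier (of_int (word_freq R ws) - z)))"
      by (simp add: G_def inner_cexpo_frame fun_eq_iff)
    moreover have "(\<lambda>z. fourier (z - k)) holomorphic_on UNIV" "(\<lambda>z. fourier (k - z)) holomorphic_on UNIV" for k
      by (rule holomorphic_on_compose[unfolded o_def, OF _ fourier_holomorphic], intro holomorphic_intros)+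
    ultimately show ?thesis
      by (auto intro!: holomorphic_on_sum holomorphic_on_mult holomorphic_on_const)
  qed
  \<comment> \<open>The arithmetic-geometric mean inequality splits the product, and the Bessel
    inequality is applied at \<open>z\<close> and at \<open>cnj z\<close>.\<close>
  have bound: "norm (G n z) \<le> (exp (2 * pi * (radius * norm z)))\<^sup>2" for n z
  proof -
    let ?a = "\<lambda>z ws. norm (L2_inner M (cexpo z) (frame ws))"
    have "norm (G n z) \<le> (\<Sum>ws\<in>Omega_upto L n. ?a z ws * ?a (cnj z) ws)"
      unfolding G_def by (rule sum_norm_le) (simp add: norm_mult)
    also have "\<dots> \<le> (\<Sum>ws\<in>Omega_upto L n. ((?a z ws)\<^sup>2 + (?a (cnj z) ws)\<^sup>2) / 2)"
    proof (rule sum_mono)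
      fix ws
      show "?a z ws * ?a (cnj z) ws \<le> ((?a z ws)\<^sup>2 + (?a (cnj z) ws)\<^sup>2) / 2"
        using sum_squares_bound[of "?a z ws" "?a (cnj z) ws"] by simp
    qed
    also have "\<dots> = (energy_upto n (cexpo z) + energy_upto n (cexpo (cnj z))) / 2"
      by (simp add: energy_upto_def sum.distrib sum_divide_distrib add_divide_distrib)
    also have "\<dots> \<le> (exp (2 * pi * (radius * norm z)))\<^sup>2"
      using energy_upto_le[OF cexpo_L2, of n z] energy_upto_le[OF cexpo_L2, of n "cnj z"]
        norm_sq_cexpo_le[of z] norm_sq_cexpo_le[of "cnj z"] by simp
    finally show ?thesis .
  qed
  have mono: "mono (\<lambda>r. (exp (2 * pi * (radius * r)))\<^sup>2)"
  proof (rule monoI)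
    fix r s :: real assume "r \<le> s"
    moreover have "0 \<le> radius" unfolding radius_def by (intro add_nonneg_nonneg sum_nonneg) auto
    ultimately show "(exp (2 * pi * (radius * r)))\<^sup>2 \<le> (exp (2 * pi * (radius * s)))\<^sup>2"
      by (auto intro!: power_mono mult_left_mono)
  qed
  obtain g r where g: "g holomorphic_on UNIV" and r: "strict_mono (r :: nat \<Rightarrow> nat)"
    and lim: "\<And>z. (\<lambda>n. G (r n) z) \<longlonglongrightarrow> g z"
    by (rule holomorphic_limit_of_bounded[of G, OF hol bound mono]) (rule that)
  have "g (of_real t) = of_real (energy (expo t))" for t
  proof (rule LIMSEQ_unique)
    show "(\<lambda>n. G (r n) (of_real t)) \<longlonglongrightarrow> g (of_real t)" by (rule lim)
    have "(\<lambda>n. energy_upto (r n) (expo t)) \<longlonglongrightarrow> energy (expo t)"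
      using LIMSEQ_subseq_LIMSEQ[OF energy_upto_tendsto[OF expo_L2] r] by (simp add: o_def)
    then show "(\<lambda>n. G (r n) (of_real t)) \<longlonglongrightarrow> of_real (energy (expo t))"
      unfolding real by (rule tendsto_of_real)
  qed
  with g that show thesis by blast
qed

text \<open>A maximum principle: a positive maximum of the harmonic function \<open>q\<close> would
  be attained on a finite set closed under admissible steps. Such a set contains 0, where
  \<open>q\<close> vanishes.\<close>

lemma defect_expo_zero:
  assumes alpha_nz: "\<forall>l\<in>L. \<alpha> l \<noteq> 0"
    and cond: "\<forall>l\<in>L. l \<noteq> 0 \<longrightarrow> cls R B l \<inter> L \<noteq> {l'\<in>L. [l' = l] (mod R)}"
  shows "defect (expo t) = 0"
proof -
  obtain g where g: "g holomorphic_on UNIV" and g_real: "\<And>t. g (of_real t) = of_real (energy (expo t))"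
    using energy_entire by blast
  define q where "q s = defect (expo s)" for s
  have q_nonneg: "0 \<le> q s" for s
    unfolding q_def by (rule defect_nonneg[OF expo_L2])
  have g_q: "g (of_real s) = of_real (1 - q s)" for s
    by (simp add: g_real q_def defect_def norm_sq_expo)
  \<comment> \<open>The interval \<open>{-D..D}\<close> contains \<open>t\<close> and is stable
    under all steps, since
    \<open>\<bar>x - l\<bar> \<le> 2 * D \<le> \<bar>R\<bar> * D\<close>.\<close>
  define D where "D = max \<bar>t\<bar> (\<Sum>l\<in>L. \<bar>real_of_int l\<bar>)"
  have q_eq: "q = (\<lambda>s. 1 - Re (g (of_real s)))"
    by (simp add: g_q fun_eq_iff)
  have "continuous_on UNIV (\<lambda>s. g (complex_of_real s))"
    by (rule continuous_on_compose2[OF holomorphic_on_imp_continuous_on[OF g]])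
       (auto intro: continuous_intros)
  then have "continuous_on {-D..D} q"
    unfolding q_eq by (intro continuous_intros) (auto intro: continuous_on_subset)
  moreover have t: "t \<in> {-D..D}"
    unfolding D_def by (auto simp: abs_if)
  ultimately obtain x0 where x0: "x0 \<in> {-D..D}" "\<And>y. y \<in> {-D..D} \<Longrightarrow> q y \<le> q x0"
    using continuous_attains_sup[of "{-D..D}" q] by auto
  define m where "m = q x0"
  have "m \<le> 0"
  proof (rule ccontr)
    assume "\<not> m \<le> 0"
    define A where "A = {x \<in> {-D..D}. q x = m}"
    \<comment> \<open>An infinite level set in a compact interval accumulates, so the identity
      theorem would make \<open>q\<close> constantly \<open>m\<close>, against
      \<open>q 0 = 0 < m\<close>.\<close>
    have "finite A"
    proof (rule ccontr)
      assume "infinite A"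
      then have "infinite (complex_of_real ` A)"
        by (simp add: finite_image_iff inj_on_def)
      moreover have "complex_of_real ` A \<subseteq> complex_of_real ` {-D..D}" unfolding A_def by auto
      moreover have "compact (complex_of_real ` {-D..D})"
        by (intro compact_continuous_image continuous_intros) auto
      ultimately obtain \<xi> where \<xi>: "\<xi> islimpt complex_of_real ` A"
        unfolding compact_eq_Bolzano_Weierstrass by blast
      have zero: "g z - of_real (1 - m) = 0" if "z \<in> complex_of_real ` A" for z
        using that by (auto simp: A_def g_q)
      have hol: "(\<lambda>z. g z - of_real (1 - m)) holomorphic_on UNIV"
        using g by (intro holomorphic_intros)
      have "g (of_real 0) - of_real (1 - m) = 0"
        by (rule analytic_continuation[OF hol open_UNIV connected_UNIV _ _ \<xi> zero]) simp_all
      then have "complex_of_real (1 - q 0) = complex_of_real (1 - m)"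
        unfolding g_q by (rule eq_iff_diff_eq_0[THEN iffD2])
      then have "q 0 = m"
        by (simp only: of_real_eq_iff)
      then show False using defect_expo_0 \<open>\<not> m \<le> 0\<close> by (simp add: q_def)
    qed
    have in_range: "(x - of_int l) / of_int R \<in> {-D..D}" if "x \<in> {-D..D}" "l \<in> L" for x l
    proof -
      have "\<bar>real_of_int l\<bar> \<le> (\<Sum>l\<in>L. \<bar>real_of_int l\<bar>)"
        using finite_L that by (intro member_le_sum) auto
      then have "\<bar>x - of_int l\<bar> \<le> 2 * D"
        using that unfolding D_def by (auto simp: abs_if split: if_splits)
      also have "\<dots> \<le> \<bar>real_of_int R\<bar> * D"
        using R that by (intro mult_right_mono) auto
      finally have "\<bar>(x - of_int l) / of_int R\<bar> \<le> D"
        using R_nz by (simp add: field_simps)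
      then show ?thesis by (simp only: atLeastAtMost_iff abs_le_iff minus_le_iff)
    qed
    have "0 \<in> A"
    proof (rule finite_invariant_set_contains_zero[OF R \<open>finite A\<close>, where L = L and G = "{y. mask y \<noteq> 0}"])
      show "A \<noteq> {}" using x0 by (auto simp: A_def m_def)
      show "\<exists>l\<in>L. (x - of_int l) / of_int R \<in> {y. mask y \<noteq> 0}" for x
      proof (rule ccontr)
        assume "\<not> ?thesis"
        then have "(\<Sum>l\<in>L. prob_step l x) = 0" by (intro sum.neutral) (auto simp: prob_step_def)
        then show False by (simp add: sum_prob_step)
      qed
    next
      fix x l assume x: "x \<in> A" and l: "l \<in> L" and mask: "(x - of_int l) / of_int R \<in> {y. mask y \<noteq> 0}"
      define y where "y l = (x - of_int l) / of_int R" for l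
      have y: "y l \<in> {-D..D}" if "l \<in> L" for l
        using in_range x that by (simp add: A_def y_def)
      have nonneg: "0 \<le> prob_step l x * (m - q (y l))" if "l \<in> L" for l
        using x0(2)[OF y[OF that]] by (simp add: prob_step_def m_def)
      \<comment> \<open>At a maximum the mean of the nonnegative gaps \<open>m - q (y l)\<close> is
        0, so each step of positive probability leads to another maximum. As all weights
        \<open>\<alpha> l\<close> are nonzero, these are the steps whose target has nonzero
        mask.\<close>
      have "(\<Sum>l\<in>L. prob_step l x * (m - q (y l))) = m * (\<Sum>l\<in>L. prob_step l x) - q x"
        unfolding q_def defect_expo_step[of x]
        by (simp add: y_def right_diff_distrib sum_subtractf sum_distrib_left mult.commute)
      also have "\<dots> = 0" using x by (simp add: sum_prob_step A_def)
      finally have "prob_step l x * (m - q (y l)) = 0"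
        using sum_nonneg_eq_0_iff[of L "\<lambda>l. prob_step l x * (m - q (y l))"] finite_L nonneg l by simp
      moreover have "prob_step l x \<noteq> 0"
        using mask l alpha_nz by (simp add: prob_step_def)
      ultimately show "(x - of_int l) / of_int R \<in> A"
        using y[OF l] by (simp add: A_def y_def)
    next
      fix x l assume l: "l \<in> L" "l \<noteq> 0" and mask: "(x - of_int l) / of_int R \<in> {y. mask y \<noteq> 0}"
      \<comment> \<open>Congruent digits always share a class, so the assumed inequality of the two
        sets yields a digit in the class that is not congruent to \<open>l\<close>. By
        \<open>mask_cls\<close> it is admissible too.\<close>
      have "{l'\<in>L. [l' = l] (mod R)} \<subseteq> cls R B l \<inter> L"
      proof
        fix l' assume l': "l' \<in> {l'\<in>L. [l' = l] (mod R)}"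
        then obtain k where k: "l' - l = R * k"
          by (auto simp: cong_iff_dvd_diff)
        have "of_int ((l' - l) * b) / real_of_int R = of_int (k * b)" for b
          unfolding k using R_nz by simp
        then have "l' \<in> cls R B l"
          by (simp only: cls_def mem_Collect_eq) simp
        then show "l' \<in> cls R B l \<inter> L" using l' by blast
      qed
      then obtain l' where "l' \<in> L" "l' \<in> cls R B l" "\<not> [l' = l] (mod R)"
        using cond l by blast
      then show "\<exists>l'\<in>L. (x - of_int l') / of_int R \<in> {y. mask y \<noteq> 0} \<and> \<not> [l' = l] (mod R)"
        using mask_cls[of l' l x] mask by (intro bexI[of _ l']) simp_all
    qed
    then have "q 0 = m" by (simp add: A_def)
    then show False using defect_expo_0 \<open>\<not> m \<le> 0\<close> by (simp add: q_def)
  qed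
  then have "q t \<le> 0" using x0(2)[OF t] by (simp add: m_def)
  then show ?thesis using q_nonneg[of t] by (simp add: q_def)
qed

end

theorem theorem5p3:
  fixes R :: int and B L :: "int set" and \<alpha> :: "int \<Rightarrow> complex"
    and M :: "real measure" and X :: "real set"
  assumes R: "\<bar>R\<bar> \<ge> 2"
    and B: "finite B" "0 \<in> B"
    and mu: "is_ifs_measure R B M"
    and X: "is_attractor R B X"
    and nov: "no_overlap R B M X"
    and L: "finite L" "0 \<in> L"
    and alpha_nz: "\<forall>l\<in>L. \<alpha> l \<noteq> 0"
    and alpha0: "\<alpha> 0 = 1"
    and orth: "\<forall>b\<in>B. \<forall>b'\<in>B.
       (\<Sum>l\<in>L. (cis (2 * pi * of_int (l * b) / of_int R) * \<alpha> l / sqrt (real (card B)))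
              * cnj (cis (2 * pi * of_int (l * b') / of_int R) * \<alpha> l / sqrt (real (card B))))
       = (if b = b' then 1 else 0)"
    and cond: "\<forall>l\<in>L. l \<noteq> 0 \<longrightarrow> cls R B l \<inter> L \<noteq> {l'\<in>L. [l' = l] (mod R)}"
  shows "parseval_frame M
           (\<lambda>ws x. word_weight \<alpha> ws * expo (of_int (word_freq R ws)) x) (Omega L)"
proof -
  interpret ifs_frame R B M L \<alpha>
    by unfold_locales (use assms in auto)
  \<comment> \<open>The vanishing of the defect on exponentials is the input from which density
    extends it to the whole space.\<close>
  interpret compact_bessel_system M frame "Omega L" radius
    by unfold_locales
       (use sets_M AE_bounded defect_expo_zero[OF alpha_nz cond] in auto)
  have "parseval_frame M frame (Omega L)"
    by (rule parseval_frameI) (rule defect_zero_L2)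
  then show ?thesis by (simp only: frame_def[abs_def])
qed

end
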